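(* Let $V$ be the value of the associated game (with payoff functions $\tilde f,\tilde g,\tilde h$) and $D_1^*=\{x\in\mathcal I:\tilde f(x)=V(x)\}$, $D_2^*=\{x\in\mathcal I:\tilde g(x)=V(x)\}$. (i) Let $U:\mathcal I\to\mathbb R$ be a continuous function and define $D_1:=\{x\in\mathcal I:\tilde f(x)=U(x)\}$, $D_2:=\{x\in\mathcal I:\tilde g(x)=U(x)\}$ and $\tau^{D_i}:=\inf\{t\ge 0: X_t\in D_i\}$, $i=1,2$. Suppose that, for each $X_0=x\in\mathcal I$, the process $e^{-r(t\wedge\tau^{D_1})}U(X_{t\wedge\tau^{D_1}})$, $0\le t\le\infty$, is a submartingale and the process $e^{-r(t\wedge\tau^{D_2})}U(X_{t\wedge\tau^{D_2}})$, $0\le t\le\infty$, is a supermartingale, and that $\tilde f(x)\le U(x)\le\tilde g(x)$ for each $x\in\mathcal I$. Then $V=U$ and $D_i^*=D_i$, $i=1,2$; that is, the global Markovian pure Nash equilibrium $(\tau^{D_1^*},\tau^{D_2^*})$ of the associated game is $(\tau^{D_1},\tau^{D_2})$ and its value is $U$. (ii) It holds that $D_1^*\cap D_2^*=B^{g\le f}$, and the value function $V$ of the associated game satisfies $$V(x)=\begin{cases}\tilde f(x), & x\in D_1^*,\\ \tilde g(x), & x\in D_2^*,\\ \tilde f(x)=\tilde g(x), & x\in D_1^*\cap D_2^*=B^{g\le f},\end{cases}$$ as well as $$V(x)=\begin{cases}h(x), & x\in B_1\subseteq D_1^*\cap D_2^*=B^{g\le f},\\ g(x), & x\in B_3\subseteq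 D_1^*\cap D_2^*=B^{g\le f},\\ f(x), & x\in B_4\subseteq D_1^*\cap D_2^*=B^{g\le f},\end{cases}$$ and $$V(x)=\begin{cases}f(x), & x\in D_1^*\cap B^{f\le g},\\ g(x), & x\in D_2^*\cap B^{f\le g},\\ f(x)=g(x), & x\in D_1^*\cap D_2^*\cap B^{f\le g}=B^{f=g}.\end{cases}$$ Moreover, for each $x\in\mathcal I$, $f(x)\le V(x)\le g(x)$ or $g(x)\le V(x)\le f(x)$.
   Context: Setting. $\mathcal I=(\alpha,\beta)$, $-\infty\le\alpha<\beta\le\infty$. $X$ is a regular one-dimensional diffusion on $\mathcal I$ solving $dX_t=\mu(X_t)dt+\sigma(X_t)dW_t$, $X_0=x$, where $\mu:\mathcal I\to\mathbb R$ and $\sigma:\mathcal I\to(0,\infty)$ are continuous, $W$ is a standard Wiener process on a complete filtered probability space satisfying the usual conditions, and the SDE has a weak solution unique in law; $\mathbb P_x,\mathbb E_x$ refer to $X_0=x$. $\mathcal F^X$ is the smallest filtration to which $X$ is adapted satisfying the usual conditions. $r\ge0$ is a constant and $f,g,h:\mathcal I\to\mathbb R$ are continuous. Topological notions for subsets of $\mathcal I$ are taken in $\mathcal I$; $\partial B$ is the boundary of $B$; $\tau^B:=\inf\{t\ge0:X_t\in B\}$; $\inf\emptyset=\infty$. Points of a set $P\subseteq\mathcal I$ are "separated" if $P\cap A$ is finite for each compact $A\subseteq\mathcal I$. Sets: $B_1=\{g\le h\le f\}$, $B_2=\{f\le h<g\}\cup\{f<h\le g\}$, $B_3=\{h<g<f\}$,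 $B_4=\{g<f<h\}$, $B_5=\{f\le g<h\}$, $B_6=\{h<f\le g\}$ (subsets of $\mathcal I$); $B^{f\le g}=\{f\le g\}$, $B^{g\le f}=\{g\le f\}$, $B^{f=g}=\{f=g\}$. Standing assumptions. (a) Each of $f,g,h$ is a difference of convex functions. (b) The points in $\bigcup_i\partial B_i$ are separated. (c) The boundaries of $\mathcal I$ are natural. (d) $\mathbb P_x$-a.s., $e^{-rt}f(X_t),e^{-rt}g(X_t),e^{-rt}h(X_t)\to0$ as $t\to\infty$; by convention $e^{-r\tau}w(X_\tau):=0$ on $\{\tau=\infty\}$ for any $w:\mathcal I\to\mathbb R$; and $\mathbb E_x(\sup_{t\ge0}e^{-rt}|f(X_t)|+\sup_{t\ge0}e^{-rt}|g(X_t)|+\sup_{t\ge0}e^{-rt}|h(X_t)|)<\infty$ for each $x$. (e) For $w\in\{f,g\}$ let $(\mathbb K_X-r)w$ be the signed measure $\mu(x)w'_-(x)dx+\frac12\sigma^2(x)w''(dx)-rw(x)dx$ ($w'_-$ left derivative, $w''$ second derivative measure), with Jordan decomposition $((\mathbb K_X-r)w)^+-((\mathbb K_X-r)w)^-$; the points in the boundary of the support of each of $((\mathbb K_X-r)f)^\pm$, $((\mathbb K_X-r)g)^\pm$ are separated. Stopping times. $\mathbb T_i$ ($i=1,2$) is the set of admissible stopping times $\tau_i=\inf\{t\ge0:\Psi^{(i)}_t\ge E_i\}$, where $\Psi^{(i)}$ is a non-decreasing, right-continuous, $\mathcal F^X$-adapted $[0,\infty]$-valued process with $\Psi^{(i)}_{0-}=0$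 and $E_i$ is $Exp(1)$-distributed and independent of all other random sources. A Markovian pure stopping time is a first entry time $\tau^D$, $D\subseteq\mathcal I$ measurable. Associated game. Define $\tilde f,\tilde g,\tilde h:\mathcal I\to\mathbb R$ by: $\tilde f=\tilde h\le\tilde g$ on $\mathcal I$; $\tilde f=f$ and $\tilde g=g$ on $B^{f\le g}$; and $\tilde f=\tilde g=\tilde h$ on $B^{g\le f}$, where this common value is $f$ on $B_4$, $g$ on $B_3$, $h$ on $B_1$. In the associated game Player 1 chooses $\tau_1\in\mathbb T_1$ to maximize and Player 2 chooses $\tau_2\in\mathbb T_2$ to minimize $$\tilde J(x;\tau_1,\tau_2)=\mathbb E_x\big(e^{-r(\tau_1\wedge\tau_2)}(\tilde f(X_{\tau_1})\mathbb I\{\tau_1<\tau_2\}+\tilde g(X_{\tau_2})\mathbb I\{\tau_1>\tau_2\}+\tilde h(X_{\tau_1})\mathbb I\{\tau_1=\tau_2\})\big).$$ Its value is $V(x)=\inf_{\tau_2\in\mathbb T_2}\sup_{\tau_1\in\mathbb T_1}\tilde J(x;\tau_1,\tau_2)=\sup_{\tau_1\in\mathbb T_1}\inf_{\tau_2\in\mathbb T_2}\tilde J(x;\tau_1,\tau_2)$. It is known that the value $V$ exists, is continuous, and is attained by the global Markovian pure Nash equilibrium $(\tau^{D_1^*},\tau^{D_2^*})$ of the associated game, i.e. $\tilde J(x;\tau_1,\tau^{D_2^*})\le\tilde J(x;\tau^{D_1^*},\tau^{D_2^*})=V(x)\le\tilde J(x;\tau^{D_1^*},\tau_2)$ for all $\tau_1\in\mathbb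 T_1,\tau_2\in\mathbb T_2,x\in\mathcal I$. *)

theory Defs
  imports "HOL-Probability.Probability"
begin

section \<open>Filtrations and martingales\<close>

text \<open>Real time is $[0,\infty)$; processes and filtrations are functions on all reals of which only
  the values at \<open>t \<ge> 0\<close> matter. Random times take values in \<open>ennreal\<close>, that is, in $[0,\infty]$.\<close>

definition filtered_measure :: "'w measure \<Rightarrow> (real \<Rightarrow> 'w measure) \<Rightarrow> bool" where
  "filtered_measure M F \<longleftrightarrow>
     (\<forall>t\<ge>0. subalgebra M (F t)) \<and> (\<forall>s\<ge>0. \<forall>t\<ge>s. sets (F s) \<subseteq> sets (F t))"

definition usual_conditions :: "'w measure \<Rightarrow> (real \<Rightarrow> 'w measure) \<Rightarrow> bool" where
  "usual_conditions M F \<longleftrightarrow>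
     complete_measure M \<and> filtered_measure M F \<and> null_sets M \<subseteq> sets (F 0) \<and>
     (\<forall>t\<ge>0. sets (F t) = (\<Inter>s\<in>{t<..}. sets (F s)))"

definition adapted :: "(real \<Rightarrow> 'w measure) \<Rightarrow> (real \<Rightarrow> 'w \<Rightarrow> 'b::topological_space) \<Rightarrow> bool" where
  "adapted F Y \<longleftrightarrow> (\<forall>t\<ge>0. Y t \<in> borel_measurable (F t))"

definition continuous_paths :: "'w measure \<Rightarrow> (real \<Rightarrow> 'w \<Rightarrow> real) \<Rightarrow> bool" where
  "continuous_paths M Y \<longleftrightarrow> (\<forall>\<omega>\<in>space M. continuous_on {0..} (\<lambda>t. Y t \<omega>))"

definition usual_natural_filtration ::
  "'w measure \<Rightarrow> (real \<Rightarrow> 'w \<Rightarrow> real) \<Rightarrow> real \<Rightarrow> 'w measure" where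
  "usual_natural_filtration M X t =
     sigma (space M) (\<Inter>{sets (G t) | G. usual_conditions M G \<and> adapted G X})"

definition sigma_infinity :: "'w measure \<Rightarrow> (real \<Rightarrow> 'w measure) \<Rightarrow> 'w measure" where
  "sigma_infinity M F = sigma (space M) (\<Union>t\<in>{0..}. sets (F t))"

definition extend_filtration ::
  "'w measure \<Rightarrow> (real \<Rightarrow> 'w measure) \<Rightarrow> ennreal \<Rightarrow> 'w measure" where
  "extend_filtration M F t = (if t = \<infinity> then sigma_infinity M F else F (enn2real t))"

text \<open>Both notions are for the time set $[0,\infty]$, with infinity included.\<close>

definition submartingale ::
  "'w measure \<Rightarrow> (ennreal \<Rightarrow> 'w measure) \<Rightarrow> (ennreal \<Rightarrow> 'w \<Rightarrow> real) \<Rightarrow> bool" where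
  "submartingale M G Y \<longleftrightarrow>
     (\<forall>t. Y t \<in> borel_measurable (G t) \<and> integrable M (Y t)) \<and>
     (\<forall>s t. s \<le> t \<longrightarrow> (AE \<omega> in M. Y s \<omega> \<le> real_cond_exp M (G s) (Y t) \<omega>))"

definition supermartingale ::
  "'w measure \<Rightarrow> (ennreal \<Rightarrow> 'w measure) \<Rightarrow> (ennreal \<Rightarrow> 'w \<Rightarrow> real) \<Rightarrow> bool" where
  "supermartingale M G Y \<longleftrightarrow>
     (\<forall>t. Y t \<in> borel_measurable (G t) \<and> integrable M (Y t)) \<and>
     (\<forall>s t. s \<le> t \<longrightarrow> (AE \<omega> in M. real_cond_exp M (G s) (Y t) \<omega> \<le> Y s \<omega>))"


section \<open>Wiener process, stochastic integral, weak solutions\<close>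

definition wiener_process ::
  "'w measure \<Rightarrow> (real \<Rightarrow> 'w measure) \<Rightarrow> (real \<Rightarrow> 'w \<Rightarrow> real) \<Rightarrow> bool" where
  "wiener_process M F W \<longleftrightarrow>
     adapted F W \<and> continuous_paths M W \<and> (AE \<omega> in M. W 0 \<omega> = 0) \<and>
     (\<forall>s\<ge>0. \<forall>t>s.
        distributed M lborel (\<lambda>\<omega>. W t \<omega> - W s \<omega>) (normal_density 0 (sqrt (t - s))) \<and>
        prob_space.indep_set M (sets (F s))
          (sets (vimage_algebra (space M) (\<lambda>\<omega>. W t \<omega> - W s \<omega>) borel)))"

text \<open>A simple integrand \<open>(n, p, \<xi>)\<close> is the process
  $\sum_{i<n} \xi_i 1_{(p_i, p_{i+1}]}$, where $\xi_i$ is bounded and known at time $p_i$.\<close>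

type_synonym 'w simple_integrand = "nat \<times> (nat \<Rightarrow> real) \<times> (nat \<Rightarrow> 'w \<Rightarrow> real)"

definition is_simple_integrand ::
  "'w measure \<Rightarrow> (real \<Rightarrow> 'w measure) \<Rightarrow> 'w simple_integrand \<Rightarrow> bool" where
  "is_simple_integrand M F = (\<lambda>(n, p, \<xi>).
     0 \<le> p 0 \<and> (\<forall>i<n. p i < p (Suc i)) \<and>
     (\<forall>i<n. \<xi> i \<in> borel_measurable (F (p i)) \<and> (\<exists>C. \<forall>\<omega>\<in>space M. \<bar>\<xi> i \<omega>\<bar> \<le> C)))"

definition simple_value :: "'w simple_integrand \<Rightarrow> real \<Rightarrow> 'w \<Rightarrow> real" where
  "simple_value = (\<lambda>(n, p, \<xi>) t \<omega>. \<Sum>i<n. \<xi> i \<omega> * indicator {p i<..p (Suc i)} t)"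

definition simple_integral ::
  "(real \<Rightarrow> 'w \<Rightarrow> real) \<Rightarrow> 'w simple_integrand \<Rightarrow> real \<Rightarrow> 'w \<Rightarrow> real" where
  "simple_integral W =
     (\<lambda>(n, p, \<xi>) t \<omega>. \<Sum>i<n. \<xi> i \<omega> * (W (min t (p (Suc i))) \<omega> - W (min t (p i)) \<omega>))"

text \<open>Uniform convergence on compacts in probability. Time \<open>0\<close> is left out because
  simple integrands vanish there; this does not affect the integral.\<close>

definition ucp_tendsto ::
  "'w measure \<Rightarrow> (nat \<Rightarrow> real \<Rightarrow> 'w \<Rightarrow> real) \<Rightarrow> (real \<Rightarrow> 'w \<Rightarrow> real) \<Rightarrow> bool" where
  "ucp_tendsto M Y Z \<longleftrightarrow>
     (\<forall>T>0. \<forall>e>0.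
        (\<lambda>n. measure M {\<omega> \<in> space M. \<exists>t\<in>{0<..T}. \<bar>Y n t \<omega> - Z t \<omega>\<bar> > e}) \<longlonglongrightarrow> 0)"

text \<open>The Ito integral $Y = \int_0^\cdot H\,dW$ of a continuous adapted integrand, obtained as usual by
  continuous extension from the simple integrands with respect to ucp convergence; \<open>Y\<close> is unique up
  to indistinguishability.\<close>

definition is_ito_integral ::
  "'w measure \<Rightarrow> (real \<Rightarrow> 'w measure) \<Rightarrow> (real \<Rightarrow> 'w \<Rightarrow> real) \<Rightarrow>
   (real \<Rightarrow> 'w \<Rightarrow> real) \<Rightarrow> (real \<Rightarrow> 'w \<Rightarrow> real) \<Rightarrow> bool" where
  "is_ito_integral M F W H Y \<longleftrightarrow>
     adapted F H \<and> continuous_paths M H \<and> adapted F Y \<and> continuous_paths M Y \<and>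
     (\<exists>S. (\<forall>n. is_simple_integrand M F (S n)) \<and>
          ucp_tendsto M (\<lambda>n. simple_value (S n)) H \<and>
          ucp_tendsto M (\<lambda>n. simple_integral W (S n)) Y)"

definition weak_solution ::
  "real set \<Rightarrow> (real \<Rightarrow> real) \<Rightarrow> (real \<Rightarrow> real) \<Rightarrow> real \<Rightarrow> 'w measure \<Rightarrow> (real \<Rightarrow> 'w measure) \<Rightarrow>
   (real \<Rightarrow> 'w \<Rightarrow> real) \<Rightarrow> (real \<Rightarrow> 'w \<Rightarrow> real) \<Rightarrow> bool" where
  "weak_solution I \<mu> \<sigma> x M F W X \<longleftrightarrow>
     prob_space M \<and> usual_conditions M F \<and> wiener_process M F W \<and>
     adapted F X \<and> continuous_paths M X \<and> (\<forall>\<omega>\<in>space M. \<forall>t\<ge>0. X t \<omega> \<in> I) \<and>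
     (\<forall>\<omega>\<in>space M. X 0 \<omega> = x) \<and>
     (\<exists>Y. is_ito_integral M F W (\<lambda>t \<omega>. \<sigma> (X t \<omega>)) Y \<and>
          (AE \<omega> in M. \<forall>t\<ge>0.
             X t \<omega> = x + (LINT s:{0..t}|lborel. \<mu> (X s \<omega>)) + Y t \<omega>))"

definition path_law :: "'w measure \<Rightarrow> (real \<Rightarrow> 'w \<Rightarrow> real) \<Rightarrow> (real \<Rightarrow> real) measure" where
  "path_law M X = distr M (\<Pi>\<^sub>M t\<in>{0..}. borel) (\<lambda>\<omega>. \<lambda>t\<in>{0..}. X t \<omega>)"

text \<open>Sample points are taken to be paths of the pair \<open>(X, W)\<close>. This is no restriction: the joint law
  of any weak solution on any probability space is realised by the coordinate processes, which again
  form a weak solution.\<close>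

definition unique_in_law :: "real set \<Rightarrow> (real \<Rightarrow> real) \<Rightarrow> (real \<Rightarrow> real) \<Rightarrow> bool" where
  "unique_in_law I \<mu> \<sigma> \<longleftrightarrow>
     (\<forall>x\<in>I. \<forall>(M :: (real \<Rightarrow> real \<times> real) measure) F W X
              (M' :: (real \<Rightarrow> real \<times> real) measure) F' W' X'.
        weak_solution I \<mu> \<sigma> x M F W X \<longrightarrow> weak_solution I \<mu> \<sigma> x M' F' W' X' \<longrightarrow>
        path_law M X = path_law M' X')"


section \<open>Natural boundaries\<close>

text \<open>Densities of scale and speed, normalised at the base point \<open>c\<close>.\<close>

definition scale_density :: "(real \<Rightarrow> real) \<Rightarrow> (real \<Rightarrow> real) \<Rightarrow> real \<Rightarrow> real \<Rightarrow> real" where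
  "scale_density \<mu> \<sigma> c y = exp (- (LBINT u=ereal c..ereal y. 2 * \<mu> u / (\<sigma> u)\<^sup>2))"

definition speed_density :: "(real \<Rightarrow> real) \<Rightarrow> (real \<Rightarrow> real) \<Rightarrow> real \<Rightarrow> real \<Rightarrow> real" where
  "speed_density \<mu> \<sigma> c y = 2 / ((\<sigma> y)\<^sup>2 * scale_density \<mu> \<sigma> c y)"

text \<open>Feller's classification, with scale function $s$ and speed measure $m$: the left endpoint is exit
  if $\int_\alpha^z m((y,z))\,s(dy)<\infty$ and entrance if
  $\int_\alpha^z s((y,z))\,m(dy)<\infty$, and likewise on the right. Both are natural if they are neither
  exit nor entrance.\<close>

definition boundary_integral_left ::
  "real set \<Rightarrow> (real \<Rightarrow> real) \<Rightarrow> (real \<Rightarrow> real) \<Rightarrow> real \<Rightarrow> ennreal" where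
  "boundary_integral_left I p q z =
     (\<integral>\<^sup>+y\<in>{y\<in>I. y < z}. (\<integral>\<^sup>+u\<in>{y<..<z}. ennreal (p u) \<partial>lborel) * ennreal (q y) \<partial>lborel)"

definition boundary_integral_right ::
  "real set \<Rightarrow> (real \<Rightarrow> real) \<Rightarrow> (real \<Rightarrow> real) \<Rightarrow> real \<Rightarrow> ennreal" where
  "boundary_integral_right I p q z =
     (\<integral>\<^sup>+y\<in>{y\<in>I. z < y}. (\<integral>\<^sup>+u\<in>{z<..<y}. ennreal (p u) \<partial>lborel) * ennreal (q y) \<partial>lborel)"

definition natural_boundaries :: "real set \<Rightarrow> (real \<Rightarrow> real) \<Rightarrow> (real \<Rightarrow> real) \<Rightarrow> bool" where
  "natural_boundaries I \<mu> \<sigma> \<longleftrightarrow>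
     \<not> (\<forall>z\<in>I. boundary_integral_left I (speed_density \<mu> \<sigma> z) (scale_density \<mu> \<sigma> z) z < \<infinity>) \<and>
     \<not> (\<forall>z\<in>I. boundary_integral_left I (scale_density \<mu> \<sigma> z) (speed_density \<mu> \<sigma> z) z < \<infinity>) \<and>
     \<not> (\<forall>z\<in>I. boundary_integral_right I (speed_density \<mu> \<sigma> z) (scale_density \<mu> \<sigma> z) z < \<infinity>) \<and>
     \<not> (\<forall>z\<in>I. boundary_integral_right I (scale_density \<mu> \<sigma> z) (speed_density \<mu> \<sigma> z) z < \<infinity>)"


section \<open>The measure \<open>(K - r) w\<close>\<close>

definition difference_of_convex :: "real set \<Rightarrow> (real \<Rightarrow> real) \<Rightarrow> bool" where
  "difference_of_convex I w \<longleftrightarrow>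
     (\<exists>p q. convex_on I p \<and> convex_on I q \<and> (\<forall>x\<in>I. w x = p x - q x))"

definition left_deriv :: "(real \<Rightarrow> real) \<Rightarrow> real \<Rightarrow> real" where
  "left_deriv w x = vector_derivative w (at_left x)"

text \<open>The signed measures at hand are only locally finite on the open interval \<open>I\<close>, so they have
  real values on Borel sets contained in a compact subset of \<open>I\<close>. They are handled through their
  Jordan decompositions: pairs of mutually singular Radon measures on \<open>I\<close>.\<close>

definition jordan_pair :: "real set \<Rightarrow> real measure \<Rightarrow> real measure \<Rightarrow> bool" where
  "jordan_pair I P N \<longleftrightarrow>
     sets P = sets (restrict_space borel I) \<and> sets N = sets (restrict_space borel I) \<and>
     (\<forall>K. compact K \<and> K \<subseteq> I \<longrightarrow> emeasure P K < \<infinity> \<and> emeasure N K < \<infinity>) \<and>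
     (\<exists>S\<in>sets P. emeasure P S = 0 \<and> emeasure N (I - S) = 0)"

definition second_derivative_measure ::
  "real set \<Rightarrow> (real \<Rightarrow> real) \<Rightarrow> real measure \<Rightarrow> real measure \<Rightarrow> bool" where
  "second_derivative_measure I w P N \<longleftrightarrow>
     jordan_pair I P N \<and>
     (\<forall>a\<in>I. \<forall>b\<in>I. a < b \<longrightarrow>
        left_deriv w b - left_deriv w a = measure P {a..<b} - measure N {a..<b})"

definition generator_measure ::
  "real set \<Rightarrow> (real \<Rightarrow> real) \<Rightarrow> (real \<Rightarrow> real) \<Rightarrow> real \<Rightarrow> (real \<Rightarrow> real) \<Rightarrow>
   real measure \<Rightarrow> real measure \<Rightarrow> bool" where
  "generator_measure I \<mu> \<sigma> r w P N \<longleftrightarrow>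
     jordan_pair I P N \<and>
     (\<exists>P2 N2. second_derivative_measure I w P2 N2 \<and>
        (\<forall>A\<in>sets borel. (\<exists>K. compact K \<and> A \<subseteq> K \<and> K \<subseteq> I) \<longrightarrow>
           measure P A - measure N A =
             (LINT y:A|lborel. \<mu> y * left_deriv w y)
             + 1 / 2 * ((LINT y:A|P2. (\<sigma> y)\<^sup>2) - (LINT y:A|N2. (\<sigma> y)\<^sup>2))
             - (LINT y:A|lborel. r * w y)))"

definition measure_support :: "real set \<Rightarrow> real measure \<Rightarrow> real set" where
  "measure_support I P = {x\<in>I. \<forall>U. open U \<and> x \<in> U \<longrightarrow> emeasure P (U \<inter> I) > 0}"

definition separated_points :: "real set \<Rightarrow> real set \<Rightarrow> bool" where
  "separated_points I P \<longleftrightarrow> (\<forall>A. compact A \<and> A \<subseteq> I \<longrightarrow> finite (P \<inter> A))"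

abbreviation boundary_in :: "real set \<Rightarrow> real set \<Rightarrow> real set" where
  "boundary_in I B \<equiv> (top_of_set I) frontier_of B"


section \<open>Payoff regions and the payoffs of the associated game\<close>

context
  fixes I :: "real set" and f g h :: "real \<Rightarrow> real"
begin

definition B1 :: "real set" where "B1 = {x\<in>I. g x \<le> h x \<and> h x \<le> f x}"
definition B2 :: "real set" where
  "B2 = {x\<in>I. f x \<le> h x \<and> h x < g x} \<union> {x\<in>I. f x < h x \<and> h x \<le> g x}"
definition B3 :: "real set" where "B3 = {x\<in>I. h x < g x \<and> g x < f x}"
definition B4 :: "real set" where "B4 = {x\<in>I. g x < f x \<and> f x < h x}"
definition B5 :: "real set" where "B5 = {x\<in>I. f x \<le> g x \<and> g x < h x}"
definition B6 :: "real set" where "B6 = {x\<in>I. h x < f x \<and> f x \<le> g x}"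

end

definition set_le :: "real set \<Rightarrow> (real \<Rightarrow> real) \<Rightarrow> (real \<Rightarrow> real) \<Rightarrow> real set" where
  "set_le I u v = {x\<in>I. u x \<le> v x}"

definition set_eq :: "real set \<Rightarrow> (real \<Rightarrow> real) \<Rightarrow> (real \<Rightarrow> real) \<Rightarrow> real set" where
  "set_eq I u v = {x\<in>I. u x = v x}"

definition associated_payoffs ::
  "real set \<Rightarrow> (real \<Rightarrow> real) \<Rightarrow> (real \<Rightarrow> real) \<Rightarrow> (real \<Rightarrow> real) \<Rightarrow>
   (real \<Rightarrow> real) \<Rightarrow> (real \<Rightarrow> real) \<Rightarrow> (real \<Rightarrow> real) \<Rightarrow> bool" where
  "associated_payoffs I f g h f' g' h' \<longleftrightarrow>
     (\<forall>x\<in>I. f' x = h' x \<and> h' x \<le> g' x) \<and>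
     (\<forall>x\<in>set_le I f g. f' x = f x \<and> g' x = g x) \<and>
     (\<forall>x\<in>set_le I g f. f' x = g' x \<and> g' x = h' x) \<and>
     (\<forall>x\<in>B4 I f g h. f' x = f x) \<and>
     (\<forall>x\<in>B3 I f g h. f' x = g x) \<and>
     (\<forall>x\<in>B1 I f g h. f' x = h x)"

text \<open>The defining properties determine the three payoffs uniquely on \<open>I\<close>.\<close>

lemma associated_payoffs_iff:
  "associated_payoffs I f g h f' g' h' \<longleftrightarrow>
     (\<forall>x\<in>I. f' x = (if f x \<le> g x then f x else min (f x) (max (g x) (h x))) \<and>
            g' x = (if f x \<le> g x then g x else min (f x) (max (g x) (h x))) \<and>
            h' x = f' x)"
  (is "?L \<longleftrightarrow> ?R")
proof
  assume L: ?L
  show ?R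
  proof
    fix x assume x: "x \<in> I"
    have 1: "f' x = h' x" "h' x \<le> g' x"
      and 2: "f x \<le> g x \<Longrightarrow> f' x = f x \<and> g' x = g x"
      and 3: "g x \<le> f x \<Longrightarrow> f' x = g' x \<and> g' x = h' x"
      and 4: "g x < f x \<Longrightarrow> f x < h x \<Longrightarrow> f' x = f x"
      and 5: "h x < g x \<Longrightarrow> g x < f x \<Longrightarrow> f' x = g x"
      and 6: "g x \<le> h x \<Longrightarrow> h x \<le> f x \<Longrightarrow> f' x = h x"
      using L x unfolding associated_payoffs_def set_le_def B1_def B3_def B4_def by blast+
    show "f' x = (if f x \<le> g x then f x else min (f x) (max (g x) (h x))) \<and>
      g' x = (if f x \<le> g x then g x else min (f x) (max (g x) (h x))) \<and> h' x = f' x"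
    proof (cases "f x \<le> g x")
      case True
      with 1(1) 2 show ?thesis by presburger
    next
      case False
      then have lt: "g x < f x" by simp
      have "f' x = min (f x) (max (g x) (h x))"
      proof -
        consider "h x < g x" | "f x < h x" | "g x \<le> h x" "h x \<le> f x" by linarith
        then show ?thesis
        proof cases
          case 1 then show ?thesis using 5 lt by simp
        next
          case 2 then show ?thesis using 4 lt by simp
        next
          case 3 then show ?thesis using 6 by simp
        qed
      qed
      with 1(1) 3 lt show ?thesis by (metis less_imp_le not_le)
    qed
  qed
next
  assume R: ?R
  have 1: "f' x = f x \<and> g' x = g x \<and> h' x = f x" if "x \<in> I" "f x \<le> g x" for x
    using R that by simp
  have 2: "f' x = min (f x) (max (g x) (h x)) \<and> g' x = f' x \<and> h' x = f' x"
    if "x \<in> I" "g x \<le> f x" for x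
    using R that by (auto simp: min_def)
  show ?L
    unfolding associated_payoffs_def
  proof (intro conjI ballI)
    fix x assume "x \<in> I"
    then show "f' x = h' x" "h' x \<le> g' x"
      using 1[of x] 2[of x] by linarith+
  next
    fix x assume "x \<in> set_le I f g"
    then show "f' x = f x" "g' x = g x"
      using 1[of x] by (simp_all add: set_le_def)
  next
    fix x assume "x \<in> set_le I g f"
    then show "f' x = g' x" "g' x = h' x"
      using 2[of x] by (simp_all add: set_le_def)
  next
    fix x assume "x \<in> B4 I f g h"
    then show "f' x = f x" using 2[of x] by (simp add: B4_def)
  next
    fix x assume "x \<in> B3 I f g h"
    then show "f' x = g x" using 2[of x] by (simp add: B3_def)
  next
    fix x assume "x \<in> B1 I f g h"
    then show "f' x = h x" using 2[of x] by (simp add: B1_def)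
  qed
qed


section \<open>Stopping times and the game\<close>

definition entry_time :: "(real \<Rightarrow> 'w \<Rightarrow> real) \<Rightarrow> real set \<Rightarrow> 'w \<Rightarrow> ennreal" where
  "entry_time X D \<omega> = Inf {ennreal t | t. 0 \<le> t \<and> X t \<omega> \<in> D}"

text \<open>The condition at \<open>0-\<close> leaves the value at time \<open>0\<close> free: the process may jump there.\<close>

definition admissible_times ::
  "'w measure \<Rightarrow> (real \<Rightarrow> 'w \<Rightarrow> real) \<Rightarrow> ('w \<Rightarrow> real) \<Rightarrow> ('w \<Rightarrow> ennreal) set" where
  "admissible_times M X E =
     {\<tau>. \<exists>\<Psi> :: real \<Rightarrow> 'w \<Rightarrow> ennreal.
        adapted (usual_natural_filtration M X) \<Psi> \<and>
        (\<forall>\<omega>\<in>space M.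
           mono_on {0..} (\<lambda>t. \<Psi> t \<omega>) \<and>
           (\<forall>t\<ge>0. continuous (at_right t) (\<lambda>s. \<Psi> s \<omega>)) \<and>
           \<tau> \<omega> = Inf {ennreal t | t. 0 \<le> t \<and> ennreal (E \<omega>) \<le> \<Psi> t \<omega>})}"

text \<open>The discounted value $e^{-r\tau} w(X_\tau)$ along one path \<open>\<gamma>\<close>, which is \<open>0\<close> if $\tau=\infty$.\<close>

definition discounted ::
  "real \<Rightarrow> (real \<Rightarrow> real) \<Rightarrow> (real \<Rightarrow> real) \<Rightarrow> ennreal \<Rightarrow> real" where
  "discounted r w \<gamma> \<tau> =
     (if \<tau> = \<infinity> then 0 else exp (- r * enn2real \<tau>) * w (\<gamma> (enn2real \<tau>)))"

definition stopped_discounted ::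
  "real \<Rightarrow> (real \<Rightarrow> real) \<Rightarrow> (real \<Rightarrow> 'w \<Rightarrow> real) \<Rightarrow> ('w \<Rightarrow> ennreal) \<Rightarrow> ennreal \<Rightarrow> 'w \<Rightarrow> real" where
  "stopped_discounted r w X \<tau> t \<omega> = discounted r w (\<lambda>s. X s \<omega>) (min t (\<tau> \<omega>))"

definition game_payoff ::
  "real \<Rightarrow> (real \<Rightarrow> real) \<Rightarrow> (real \<Rightarrow> real) \<Rightarrow> (real \<Rightarrow> real) \<Rightarrow>
   'w measure \<Rightarrow> (real \<Rightarrow> 'w \<Rightarrow> real) \<Rightarrow> ('w \<Rightarrow> ennreal) \<Rightarrow> ('w \<Rightarrow> ennreal) \<Rightarrow> real" where
  "game_payoff r f g h M X \<tau>1 \<tau>2 =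
     (LINT \<omega>|M.
        (if \<tau>1 \<omega> < \<tau>2 \<omega> then discounted r f (\<lambda>t. X t \<omega>) (\<tau>1 \<omega>)
        else if \<tau>2 \<omega> < \<tau>1 \<omega> then discounted r g (\<lambda>t. X t \<omega>) (\<tau>2 \<omega>)
        else discounted r h (\<lambda>t. X t \<omega>) (\<tau>1 \<omega>)))"

text \<open>In the following two notions \<open>M x\<close>, \<open>X x\<close>, \<open>E1 x\<close>, \<open>E2 x\<close> are the probability
  space, the diffusion and the randomisation devices for the initial value \<open>x\<close>.\<close>

definition is_game_value ::
  "real set \<Rightarrow> real \<Rightarrow> (real \<Rightarrow> real) \<Rightarrow> (real \<Rightarrow> real) \<Rightarrow> (real \<Rightarrow> real) \<Rightarrow>
   (real \<Rightarrow> 'w measure) \<Rightarrow> (real \<Rightarrow> real \<Rightarrow> 'w \<Rightarrow> real) \<Rightarrow>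
   (real \<Rightarrow> 'w \<Rightarrow> real) \<Rightarrow> (real \<Rightarrow> 'w \<Rightarrow> real) \<Rightarrow> (real \<Rightarrow> real) \<Rightarrow> bool" where
  "is_game_value I r f g h M X E1 E2 V \<longleftrightarrow>
     (\<forall>x\<in>I.
        ereal (V x) = (INF \<tau>2\<in>admissible_times (M x) (X x) (E2 x).
                         SUP \<tau>1\<in>admissible_times (M x) (X x) (E1 x).
                           ereal (game_payoff r f g h (M x) (X x) \<tau>1 \<tau>2)) \<and>
        ereal (V x) = (SUP \<tau>1\<in>admissible_times (M x) (X x) (E1 x).
                         INF \<tau>2\<in>admissible_times (M x) (X x) (E2 x).
                           ereal (game_payoff r f g h (M x) (X x) \<tau>1 \<tau>2)))"

definition global_markovian_nash ::
  "real set \<Rightarrow> real \<Rightarrow> (real \<Rightarrow> real) \<Rightarrow> (real \<Rightarrow> real) \<Rightarrow> (real \<Rightarrow> real) \<Rightarrow>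
   (real \<Rightarrow> 'w measure) \<Rightarrow> (real \<Rightarrow> real \<Rightarrow> 'w \<Rightarrow> real) \<Rightarrow>
   (real \<Rightarrow> 'w \<Rightarrow> real) \<Rightarrow> (real \<Rightarrow> 'w \<Rightarrow> real) \<Rightarrow> real set \<Rightarrow> real set \<Rightarrow> bool" where
  "global_markovian_nash I r f g h M X E1 E2 D1 D2 \<longleftrightarrow>
     D1 \<subseteq> I \<and> D2 \<subseteq> I \<and> D1 \<in> sets borel \<and> D2 \<in> sets borel \<and>
     (\<forall>x\<in>I.
        entry_time (X x) D1 \<in> admissible_times (M x) (X x) (E1 x) \<and>
        entry_time (X x) D2 \<in> admissible_times (M x) (X x) (E2 x) \<and>
        (\<forall>\<tau>1\<in>admissible_times (M x) (X x) (E1 x).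
           game_payoff r f g h (M x) (X x) \<tau>1 (entry_time (X x) D2)
           \<le> game_payoff r f g h (M x) (X x) (entry_time (X x) D1) (entry_time (X x) D2)) \<and>
        (\<forall>\<tau>2\<in>admissible_times (M x) (X x) (E2 x).
           game_payoff r f g h (M x) (X x) (entry_time (X x) D1) (entry_time (X x) D2)
           \<le> game_payoff r f g h (M x) (X x) (entry_time (X x) D1) \<tau>2))"


section \<open>Standing assumptions\<close>

text \<open>\<open>E1\<close>, \<open>E2\<close> and the filtered space carrying the diffusion are mutually independent.\<close>

definition randomisation_devices ::
  "'w measure \<Rightarrow> (real \<Rightarrow> 'w measure) \<Rightarrow> ('w \<Rightarrow> real) \<Rightarrow> ('w \<Rightarrow> real) \<Rightarrow> bool" where
  "randomisation_devices M F E1 E2 \<longleftrightarrow>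
     (\<forall>\<omega>\<in>space M. 0 < E1 \<omega> \<and> 0 < E2 \<omega>) \<and>
     distributed M lborel E1 (exponential_density 1) \<and>
     distributed M lborel E2 (exponential_density 1) \<and>
     prob_space.indep_sets M
       (\<lambda>k::nat. if k = 0 then sets (sigma_infinity M F)
                 else if k = 1 then sets (vimage_algebra (space M) E1 borel)
                 else sets (vimage_algebra (space M) E2 borel)) {0, 1, 2}"

locale diffusion =
  fixes \<alpha> \<beta> :: ereal and I :: "real set" and \<mu> \<sigma> :: "real \<Rightarrow> real"
    and M :: "real \<Rightarrow> 'w measure" and F :: "real \<Rightarrow> real \<Rightarrow> 'w measure"
    and W X :: "real \<Rightarrow> real \<Rightarrow> 'w \<Rightarrow> real"
  assumes endpoints: "\<alpha> < \<beta>"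
    and state_space: "I = einterval \<alpha> \<beta>"
    and drift_continuous: "continuous_on I \<mu>"
    and volatility_continuous: "continuous_on I \<sigma>"
    and volatility_pos: "\<And>x. x \<in> I \<Longrightarrow> 0 < \<sigma> x"
    and solution: "\<And>x. x \<in> I \<Longrightarrow> weak_solution I \<mu> \<sigma> x (M x) (F x) (W x) (X x)"
    and uniqueness: "unique_in_law I \<mu> \<sigma>"
    and regular: "\<And>x y. x \<in> I \<Longrightarrow> y \<in> I \<Longrightarrow>
      0 < measure (M x) {\<omega> \<in> space (M x). \<exists>t\<ge>0. X x t \<omega> = y}"
    and natural: "natural_boundaries I \<mu> \<sigma>"

locale stopping_game_setting = diffusion \<alpha> \<beta> I \<mu> \<sigma> M F W X
  for \<alpha> \<beta> :: ereal and I :: "real set" and \<mu> \<sigma> :: "real \<Rightarrow> real"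
    and M :: "real \<Rightarrow> 'w measure" and F :: "real \<Rightarrow> real \<Rightarrow> 'w measure"
    and W X :: "real \<Rightarrow> real \<Rightarrow> 'w \<Rightarrow> real" +
  fixes E1 E2 :: "real \<Rightarrow> 'w \<Rightarrow> real" and r :: real and f g h :: "real \<Rightarrow> real"
  assumes devices: "\<And>x. x \<in> I \<Longrightarrow> randomisation_devices (M x) (F x) (E1 x) (E2 x)"
    and discount_nonneg: "0 \<le> r"
    and payoff_continuous: "\<And>w. w \<in> {f, g, h} \<Longrightarrow> continuous_on I w"
    and payoff_dc: "\<And>w. w \<in> {f, g, h} \<Longrightarrow> difference_of_convex I w"
    and regions_separated:
      "separated_points I
         (\<Union>B\<in>{B1 I f g h, B2 I f g h, B3 I f g h, B4 I f g h, B5 I f g h, B6 I f g h}.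
            boundary_in I B)"
    and payoff_vanishes: "\<And>w x. w \<in> {f, g, h} \<Longrightarrow> x \<in> I \<Longrightarrow>
      AE \<omega> in M x. ((\<lambda>t. exp (- r * t) * w (X x t \<omega>)) \<longlongrightarrow> 0) at_top"
    and payoff_integrable: "\<And>x. x \<in> I \<Longrightarrow>
      (\<integral>\<^sup>+\<omega>. (SUP t\<in>{0..}. ennreal (exp (- r * t) * \<bar>f (X x t \<omega>)\<bar>))
          + (SUP t\<in>{0..}. ennreal (exp (- r * t) * \<bar>g (X x t \<omega>)\<bar>))
          + (SUP t\<in>{0..}. ennreal (exp (- r * t) * \<bar>h (X x t \<omega>)\<bar>)) \<partial>M x) < \<infinity>"
    and generator_separated: "\<And>w. w \<in> {f, g} \<Longrightarrow>
      \<exists>P N. generator_measure I \<mu> \<sigma> r w P N \<and>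
            separated_points I (boundary_in I (measure_support I P)) \<and>
            separated_points I (boundary_in I (measure_support I N))"

end

theory Submission
  imports Defs
begin

text \<open>Suppose that \<open>U\<close> lies between the payoffs \<open>f' \<le> g'\<close> of the associated game, is a
  discounted submartingale until the entry into \<open>D1 = {f' = U}\<close> and a discounted supermartingale until the
  entry into \<open>D2 = {g' = U}\<close>. If the minimiser stops on entry into \<open>D2\<close>, then whatever the maximiser does,
  the outcome of the game is at most the stopped discounted value of \<open>U\<close>: before the entry the maximiser
  collects \<open>f' \<le> U\<close>, and at the entry \<open>g' = U\<close>. Optional stopping bounds its mean by \<open>U x\<close>
  (\<open>entry_D2_guarantees_minimiser\<close>). Symmetrically, stopping on entry into \<open>D1\<close> guarantees at least \<open>U x\<close> to the maximiser
  (\<open>entry_D1_guarantees_maximiser\<close>). Hence both the upper and the lower value equal \<open>U x\<close> and the two entry times form an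
  equilibrium.

  The work lies in optional stopping for a time that is randomised by an independent exponential variable
  \<open>E\<close> (\<open>optional_stopping_randomised\<close>). Such a time need not be a stopping time of the filtration of \<open>X\<close>, but it
  exceeds a fixed time \<open>s\<close> exactly if a process \<open>\<Psi>\<close> known at time \<open>s\<close> is still below \<open>E\<close>. Given \<open>E = u\<close>
  this event belongs to the filtration, so by Fubini's theorem the mean of a supermartingale increment
  after \<open>s\<close> on that event is at most \<open>0\<close> (\<open>independent_level_integral_le\<close>). Summing over the cells of a
  grid on the closed time set and letting the mesh tend to \<open>0\<close> gives the claim, with the running suprema of
  the payoffs as an integrable envelope (\<open>envelope_exists\<close>).

  The description of the value rests on stopping at once, which is open to either player, so that
  \<open>f' \<le> V \<le> g'\<close> (\<open>associated_value_between\<close>). Moreover \<open>f' = min f (max g h)\<close> and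
  \<open>g' = max g (min f h)\<close> on all of \<open>I\<close> (\<open>associated_payoffs_lattice\<close>), which agree exactly where
  \<open>g \<le> f\<close>. All identities for \<open>V\<close> follow by comparing the four numbers \<open>f\<close>, \<open>g\<close>, \<open>h\<close>, \<open>V\<close> at a point.\<close>


section \<open>Discretising a path from the right\<close>

text \<open>A mesh of the closed time set: as \<open>n\<close> grows it becomes finer and, because of the square, also
  extends further, up to the time \<open>n + 1\<close>. The point at infinity closes it, so that every time has a
  grid point to its right.\<close>

definition grid :: "nat \<Rightarrow> nat \<Rightarrow> ennreal" where
  "grid n k = (if k \<le> Suc n * Suc n then ennreal (real k / real (Suc n)) else \<infinity>)"

text \<open>The telescoping form of the value of \<open>z\<close> at the first grid point not before \<open>\<tau>\<close>. It
  depends on \<open>\<tau>\<close> only through the events \<open>grid n k < \<tau>\<close>, each of which is decided at the time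
  \<open>grid n k\<close> at which the increment next to it begins.\<close>

definition grid_sum :: "nat \<Rightarrow> (ennreal \<Rightarrow> real) \<Rightarrow> ennreal \<Rightarrow> real" where
  "grid_sum n z \<tau> = z 0 + (\<Sum>k\<le>Suc n * Suc n.
     (if grid n k < \<tau> then 1 else 0) * (z (grid n (Suc k)) - z (grid n k)))"

lemma grid_mono: "k \<le> l \<Longrightarrow> grid n k \<le> grid n l"
  by (auto simp: grid_def intro!: ennreal_leI divide_right_mono)

lemma grid_finite: "k \<le> Suc n * Suc n \<Longrightarrow> grid n k = ennreal (real k / real (Suc n))"
  by (simp add: grid_def)

lemma grid_0 [simp]: "grid n 0 = 0"
  by (simp add: grid_def)

lemma grid_sum_eq:
  obtains j where "grid_sum n z \<tau> = z (grid n j)" "\<tau> \<le> grid n j"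
    "j = 0 \<or> grid n (j - 1) < \<tau>" "j \<le> Suc (Suc n * Suc n)"
proof -
  define N where "N = Suc n * Suc n"
  define j where "j = (LEAST k. \<tau> \<le> grid n k)"
  have top: "\<tau> \<le> grid n (Suc N)"
    by (simp add: grid_def N_def)
  have \<tau>: "\<tau> \<le> grid n j"
    unfolding j_def by (rule LeastI, rule top)
  have jN: "j \<le> Suc N"
    unfolding j_def by (rule Least_le, rule top)
  have less: "grid n k < \<tau> \<longleftrightarrow> k < j" for k
  proof
    assume "grid n k < \<tau>"
    with \<tau> have "grid n k < grid n j" by simp
    then show "k < j" using grid_mono[of j k n] by (metis not_le)
  next
    assume "k < j"
    then show "grid n k < \<tau>" unfolding j_def by (metis not_less_Least not_le)
  qed
  have "(\<Sum>k\<le>N. (if grid n k < \<tau> then 1 else 0) * (z (grid n (Suc k)) - z (grid n k)))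
      = (\<Sum>k\<in>{..N}. if k < j then z (grid n (Suc k)) - z (grid n k) else 0)"
    by (intro sum.cong) (auto simp: less)
  also have "\<dots> = (\<Sum>k\<in>{..<j}. z (grid n (Suc k)) - z (grid n k))"
    using jN by (intro sum.mono_neutral_cong_right) auto
  also have "\<dots> = z (grid n j) - z (grid n 0)"
    by (rule sum_lessThan_telescope)
  finally have "grid_sum n z \<tau> = z (grid n j)"
    by (simp add: grid_sum_def N_def)
  moreover have "j = 0 \<or> grid n (j - 1) < \<tau>"
    unfolding less by (cases j) auto
  ultimately show thesis
    using that \<tau> jN unfolding N_def by blast
qed

lemma grid_sum_infinity: "grid_sum n z \<infinity> = z \<infinity>"
  by (metis grid_sum_eq infinity_ennreal_def top_unique)

lemma grid_sum_finite:
  assumes "0 \<le> a" "a \<le> real (Suc n)"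
  shows "\<exists>s. a \<le> s \<and> s \<le> a + 1 / real (Suc n) \<and> grid_sum n z (ennreal a) = z (ennreal s)"
proof -
  obtain j where j: "grid_sum n z (ennreal a) = z (grid n j)" "ennreal a \<le> grid n j"
      "j = 0 \<or> grid n (j - 1) < ennreal a" "j \<le> Suc (Suc n * Suc n)"
    by (rule grid_sum_eq)
  have jN: "j \<le> Suc n * Suc n"
  proof (rule ccontr)
    assume *: "\<not> ?thesis"
    then have "j - 1 = Suc n * Suc n" using j(4) by simp
    then have "grid n (j - 1) = ennreal (real (Suc n))"
      using grid_finite[of "Suc n * Suc n" n]
      by (metis nonzero_mult_div_cancel_right of_nat_0_eq_iff of_nat_mult order_refl nat.distinct(1))
    with * j(3) have "ennreal (real (Suc n)) < ennreal a" by auto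
    then have "real (Suc n) < a" by (subst (asm) ennreal_less_iff) simp
    with assms(2) show False by simp
  qed
  have "a \<le> real j / real (Suc n)"
    using j(2) assms(1) by (simp add: grid_finite[OF jN])
  moreover have "real j / real (Suc n) \<le> a + 1 / real (Suc n)"
  proof (cases "j = 0")
    case False
    have "real (j - 1) / real (Suc n) < a"
      using j(3) False jN by (subst (asm) grid_finite) (auto simp: ennreal_less_iff)
    then have "real (j - 1) / real (Suc n) + 1 / real (Suc n) \<le> a + 1 / real (Suc n)"
      by simp
    then show ?thesis
      using False by (simp add: add_divide_distrib[symmetric] of_nat_diff)
  qed (use assms in simp)
  ultimately show ?thesis
    using j(1) grid_finite[OF jN] by metis
qed

text \<open>At a finite time the first grid point from the right converges to it; at infinity the grid value is
  exact.\<close>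

lemma grid_sum_tendsto:
  assumes cont: "continuous_on {0..} (\<lambda>s. z (ennreal s))"
  shows "(\<lambda>n. grid_sum n z \<tau>) \<longlonglongrightarrow> z \<tau>"
proof (cases \<tau>)
  case (real a)
  have "\<forall>n. \<exists>s. a \<le> real (Suc n) \<longrightarrow>
      a \<le> s \<and> s \<le> a + 1 / real (Suc n) \<and> grid_sum n z (ennreal a) = z (ennreal s)"
    using grid_sum_finite[OF real(1)] by blast
  then obtain s where s: "\<And>n. a \<le> real (Suc n) \<Longrightarrow>
      a \<le> s n \<and> s n \<le> a + 1 / real (Suc n) \<and> grid_sum n z (ennreal a) = z (ennreal (s n))"
    by metis
  have large: "eventually (\<lambda>n. a \<le> real (Suc n)) sequentially"
    using eventually_ge_at_top[of "nat \<lceil>a\<rceil>"] by eventually_elim linarith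
  have "s \<longlonglongrightarrow> a"
  proof (rule tendsto_sandwich)
    show "eventually (\<lambda>n. a \<le> s n) sequentially"
      using large by eventually_elim (use s in blast)
    show "eventually (\<lambda>n. s n \<le> a + 1 / real (Suc n)) sequentially"
      using large by eventually_elim (use s in blast)
    show "(\<lambda>n. a + 1 / real (Suc n)) \<longlonglongrightarrow> a"
      using tendsto_add[OF tendsto_const LIMSEQ_Suc[OF lim_inverse_n'], of a] by simp
  qed simp
  moreover have "eventually (\<lambda>n. s n \<in> {0..}) sequentially"
    using large by eventually_elim (use s real(1) in force)
  ultimately have "(\<lambda>n. z (ennreal (s n))) \<longlonglongrightarrow> z (ennreal a)"
    using continuous_on_tendsto_compose[OF cont] real(1) by simp
  moreover have "eventually (\<lambda>n. z (ennreal (s n)) = grid_sum n z \<tau>) sequentially"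
    using large by eventually_elim (use s real(2) in simp)
  ultimately show ?thesis
    using real(2) by (simp add: tendsto_cong)
qed (use grid_sum_infinity in simp)

lemma grid_sum_bound:
  assumes "\<And>t. \<bar>z t\<bar> \<le> b"
  shows "\<bar>grid_sum n z \<tau>\<bar> \<le> b"
  by (metis assms grid_sum_eq)

lemma measurable_grid_sum:
  assumes [measurable]: "\<And>t. Z t \<in> borel_measurable M" "\<tau> \<in> borel_measurable M"
  shows "(\<lambda>\<omega>. grid_sum n (\<lambda>t. Z t \<omega>) (\<tau> \<omega>)) \<in> borel_measurable M"
  unfolding grid_sum_def by measurable

lemma measurable_at_random_time:
  fixes Z :: "ennreal \<Rightarrow> 'w \<Rightarrow> real"
  assumes "\<And>t. Z t \<in> borel_measurable M" "\<tau> \<in> borel_measurable M"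
    and "\<And>\<omega>. \<omega> \<in> space M \<Longrightarrow> continuous_on {0..} (\<lambda>s. Z (ennreal s) \<omega>)"
  shows "(\<lambda>\<omega>. Z (\<tau> \<omega>) \<omega>) \<in> borel_measurable M"
proof (rule borel_measurable_LIMSEQ_real)
  show "(\<lambda>n. grid_sum n (\<lambda>t. Z t \<omega>) (\<tau> \<omega>)) \<longlonglongrightarrow> Z (\<tau> \<omega>) \<omega>" if "\<omega> \<in> space M" for \<omega>
    using grid_sum_tendsto[OF assms(3)[OF that]] .
qed (rule measurable_grid_sum[OF assms(1,2)])

lemma upper_approximation_tendsto:
  fixes a :: real
  assumes "0 \<le> a"
  shows "(\<lambda>m. real (nat \<lceil>a * real (Suc m)\<rceil>) / real (Suc m)) \<longlonglongrightarrow> a"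
proof (rule tendsto_sandwich)
  have *: "a * real (Suc m) \<le> real (nat \<lceil>a * real (Suc m)\<rceil>)"
      "real (nat \<lceil>a * real (Suc m)\<rceil>) \<le> a * real (Suc m) + 1" for m
    using assms by (auto simp: real_nat_ceiling_ge of_nat_nat)
  show "eventually (\<lambda>m. a \<le> real (nat \<lceil>a * real (Suc m)\<rceil>) / real (Suc m)) sequentially"
    using *(1) by (simp add: field_simps)
  show "eventually (\<lambda>m. real (nat \<lceil>a * real (Suc m)\<rceil>) / real (Suc m) \<le> a + 1 / real (Suc m)) sequentially"
  proof (rule always_eventually, rule allI)
    fix m
    have "real (nat \<lceil>a * real (Suc m)\<rceil>) / real (Suc m) \<le> (a * real (Suc m) + 1) / real (Suc m)"
      by (rule divide_right_mono[OF *(2)]) simp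
    then show "real (nat \<lceil>a * real (Suc m)\<rceil>) / real (Suc m) \<le> a + 1 / real (Suc m)"
      by (simp add: add_divide_distrib)
  qed
  show "(\<lambda>n. a + 1 / real (Suc n)) \<longlonglongrightarrow> a"
    using tendsto_add[OF tendsto_const LIMSEQ_Suc[OF lim_inverse_n'], of a] by simp
qed simp

lemma SUP_continuous_eq_SUP_rational:
  fixes y :: "real \<Rightarrow> real"
  assumes cont: "continuous_on {0..} y"
  shows "(SUP t\<in>{0..}. ennreal (y t))
    = (SUP k::nat. SUP m::nat. ennreal (y (real k / real (Suc m))))" (is "?L = ?R")
proof (rule antisym)
  show "?L \<le> ?R"
  proof (rule SUP_least)
    fix t :: real assume t: "t \<in> {0..}"
    have "(\<lambda>m. y (real (nat \<lceil>t * real (Suc m)\<rceil>) / real (Suc m))) \<longlonglongrightarrow> y t"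
      using upper_approximation_tendsto[of t] t
      by (intro continuous_on_tendsto_compose[OF cont] always_eventually allI)
        (simp_all only: atLeast_iff divide_nonneg_nonneg of_nat_0_le_iff)
    then have "(\<lambda>m. ennreal (y (real (nat \<lceil>t * real (Suc m)\<rceil>) / real (Suc m)))) \<longlonglongrightarrow> ennreal (y t)"
      by (rule tendsto_ennrealI)
    then show "ennreal (y t) \<le> ?R"
    proof (rule LIMSEQ_le_const2, intro exI allI impI)
      fix m
      show "ennreal (y (real (nat \<lceil>t * real (Suc m)\<rceil>) / real (Suc m))) \<le> ?R"
        by (intro SUP_upper2[of "nat \<lceil>t * real (Suc m)\<rceil>"] SUP_upper2[of m]) auto
    qed
  qed
  show "?R \<le> ?L"
    by (intro SUP_least SUP_upper) auto
qed
section \<open>A continuous adapted process and its natural filtration\<close>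

locale continuous_adapted_process = prob_space M
  for M :: "'w measure" and F :: "real \<Rightarrow> 'w measure" and X :: "real \<Rightarrow> 'w \<Rightarrow> real"
    and I :: "real set" and x :: real +
  assumes usual: "usual_conditions M F"
    and adapted_X: "adapted F X"
    and paths: "continuous_paths M X"
    and state_space_open: "open I"
    and in_state_space: "\<And>\<omega> t. \<omega> \<in> space M \<Longrightarrow> 0 \<le> t \<Longrightarrow> X t \<omega> \<in> I"
    and start: "\<And>\<omega>. \<omega> \<in> space M \<Longrightarrow> X 0 \<omega> = x"
begin

abbreviation FX :: "real \<Rightarrow> 'w measure" where
  "FX \<equiv> usual_natural_filtration M X"

lemma filtration_space: "usual_conditions M G \<Longrightarrow> 0 \<le> t \<Longrightarrow> space (G t) = space M"
  unfolding usual_conditions_def filtered_measure_def subalgebra_def by blast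

lemma filtration_sets_le: "usual_conditions M G \<Longrightarrow> 0 \<le> t \<Longrightarrow> sets (G t) \<subseteq> sets M"
  unfolding usual_conditions_def filtered_measure_def subalgebra_def by blast

lemma filtration_mono: "usual_conditions M G \<Longrightarrow> 0 \<le> s \<Longrightarrow> s \<le> t \<Longrightarrow> sets (G s) \<subseteq> sets (G t)"
  unfolding usual_conditions_def filtered_measure_def by blast

lemma space_FX [simp]: "space (FX t) = space M"
  by (simp add: usual_natural_filtration_def space_measure_of_conv)

text \<open>The intersection that generates \<open>FX t\<close> is itself a \<open>\<sigma>\<close>-algebra, so membership can be
  tested in each competing filtration.\<close>

lemma sets_FX_iff:
  assumes t: "0 \<le> t"
  shows "A \<in> sets (FX t) \<longleftrightarrow> (\<forall>G. usual_conditions M G \<and> adapted G X \<longrightarrow> A \<in> sets (G t))"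
proof -
  let ?C = "\<Inter>{sets (G t) | G. usual_conditions M G \<and> adapted G X}"
  have sub: "?C \<subseteq> sets (G t)" if "usual_conditions M G" "adapted G X" for G
    using that by blast
  have "?C \<subseteq> sets (F t)"
    by (rule sub[OF usual adapted_X])
  also have "\<dots> \<subseteq> Pow (space M)"
    using filtration_space[OF usual t] sets.space_closed by metis
  finally have "sets (FX t) = sigma_sets (space M) ?C"
    unfolding usual_natural_filtration_def by (rule sets_measure_of)
  moreover have "sigma_sets (space M) ?C \<subseteq> sets (G t)" if "usual_conditions M G" "adapted G X" for G
    using sets.sigma_sets_subset[OF sub[OF that]] filtration_space[OF that(1) t] by simp
  ultimately have "A \<in> sets (FX t) \<longleftrightarrow> A \<in> ?C"
    using usual adapted_X by (blast intro: sigma_sets.Basic)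
  then show ?thesis by blast
qed

lemma FX_le_F: "0 \<le> t \<Longrightarrow> sets (FX t) \<subseteq> sets (F t)"
  using sets_FX_iff usual adapted_X by blast

lemma FX_mono: "0 \<le> s \<Longrightarrow> s \<le> t \<Longrightarrow> sets (FX s) \<subseteq> sets (FX t)"
proof
  fix A assume s: "0 \<le> s" "s \<le> t" and A: "A \<in> sets (FX s)"
  have "A \<in> sets (G t)" if "usual_conditions M G" "adapted G X" for G
    using sets_FX_iff[of s A] A filtration_mono[OF that(1) s] s(1) that by blast
  then show "A \<in> sets (FX t)"
    using sets_FX_iff[of t A] s by simp
qed

lemma FX_le_M: "0 \<le> t \<Longrightarrow> sets (FX t) \<subseteq> sets M"
  using FX_le_F filtration_sets_le[OF usual] by blast

lemma adapted_FX: "adapted FX X"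
  unfolding adapted_def
proof (intro allI impI measurableI)
  fix t :: real and A :: "real set" assume t: "0 \<le> t" and A: "A \<in> sets borel"
  show "X t -` A \<inter> space (FX t) \<in> sets (FX t)"
    unfolding sets_FX_iff[OF t]
  proof (intro allI impI)
    fix G assume G: "usual_conditions M G \<and> adapted G X"
    then have "X t \<in> borel_measurable (G t)" using t by (simp add: adapted_def)
    from measurable_sets[OF this A] show "X t -` A \<inter> space (FX t) \<in> sets (G t)"
      using filtration_space[of G t] G t by simp
  qed
qed simp

lemma subalgebra_FX: "0 \<le> t \<Longrightarrow> subalgebra M (FX t)"
  using FX_le_M by (simp add: subalgebra_def)

lemma filtration_le_sigma_infinity:
  assumes t: "0 \<le> t" and sp: "\<And>s. 0 \<le> s \<Longrightarrow> space (G s) = space M"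
  shows "sets (G t) \<subseteq> sets (sigma_infinity M G)"
proof -
  have "(\<Union>t\<in>{0..}. sets (G t)) \<subseteq> Pow (space M)"
    using sp sets.sets_into_space by fastforce
  then have "sets (sigma_infinity M G) = sigma_sets (space M) (\<Union>t\<in>{0..}. sets (G t))"
    unfolding sigma_infinity_def by (rule sets_measure_of)
  then show ?thesis using t by (auto intro: sigma_sets.Basic)
qed

lemma sigma_infinity_le:
  assumes sp: "\<And>s. 0 \<le> s \<Longrightarrow> space (G s) = space M"
    and le: "\<And>s. 0 \<le> s \<Longrightarrow> sets (G s) \<subseteq> sets N" and N: "space N = space M"
  shows "sets (sigma_infinity M G) \<subseteq> sets N"
proof -
  have "(\<Union>t\<in>{0..}. sets (G t)) \<subseteq> Pow (space M)"
    using sp sets.sets_into_space by fastforce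
  then have "sets (sigma_infinity M G) = sigma_sets (space M) (\<Union>t\<in>{0..}. sets (G t))"
    unfolding sigma_infinity_def by (rule sets_measure_of)
  then show ?thesis
    using le sets.sigma_sets_subset[of "\<Union>t\<in>{0..}. sets (G t)" N] N by auto
qed

lemma space_sigma_infinity [simp]: "space (sigma_infinity M G) = space M"
  by (simp add: sigma_infinity_def space_measure_of_conv)

lemma sigma_infinity_F_le_M: "sets (sigma_infinity M F) \<subseteq> sets M"
  by (rule sigma_infinity_le) (use filtration_space[OF usual] filtration_sets_le[OF usual] in auto)

lemma sigma_infinity_FX_le_F: "sets (sigma_infinity M FX) \<subseteq> sets (sigma_infinity M F)"
proof (rule sigma_infinity_le)
  fix s :: real assume "0 \<le> s"
  then show "sets (FX s) \<subseteq> sets (sigma_infinity M F)"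
    using FX_le_F filtration_le_sigma_infinity[of s F] filtration_space[OF usual] by blast
qed simp_all

lemma extend_FX_le_sigma_infinity: "sets (extend_filtration M FX t) \<subseteq> sets (sigma_infinity M FX)"
  using filtration_le_sigma_infinity[of "enn2real t" FX] by (simp add: extend_filtration_def)

lemma subalgebra_extend_FX: "subalgebra M (extend_filtration M FX t)"
proof -
  have "sets (extend_filtration M FX t) \<subseteq> sets M"
    using extend_FX_le_sigma_infinity sigma_infinity_FX_le_F sigma_infinity_F_le_M
    by (rule order_trans[OF order_trans])
  then show ?thesis by (simp add: subalgebra_def extend_filtration_def)
qed

lemma continuous_path: "\<omega> \<in> space M \<Longrightarrow> continuous_on {0..} (\<lambda>t. X t \<omega>)"
  using paths by (simp add: continuous_paths_def)

lemma continuous_path_image: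
  assumes "continuous_on I w" "\<omega> \<in> space M"
  shows "continuous_on {0..} (\<lambda>t. w (X t \<omega>))"
  by (rule continuous_on_compose2[OF assms(1) continuous_path[OF assms(2)]])
    (use in_state_space assms in auto)

lemma measurable_path_image:
  assumes w: "continuous_on I w" and t: "0 \<le> t"
  shows "(\<lambda>\<omega>. w (X t \<omega>)) \<in> borel_measurable (FX t)"
proof -
  have "X t \<in> measurable (FX t) (restrict_space borel I)"
    using adapted_FX t in_state_space by (intro measurable_restrict_space2) (auto simp: adapted_def)
  moreover have "w \<in> borel_measurable (restrict_space borel I)"
    by (rule borel_measurable_continuous_on_restrict[OF w])
  ultimately show ?thesis by (rule measurable_compose)
qed

lemma measurable_FX_M: "0 \<le> t \<Longrightarrow> Z \<in> measurable (FX t) N \<Longrightarrow> Z \<in> measurable M N"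
  by (rule measurable_from_subalg[OF subalgebra_FX])


section \<open>First entry into the zero set of a continuous function\<close>

text \<open>The times spent by a continuous path in the zero set of \<open>\<phi>\<close> are closed in \<open>{0..}\<close>, although
  \<open>D\<close> is closed only relative to \<open>I\<close>: the path never leaves \<open>I\<close>.\<close>

lemma entry_time_attained:
  fixes \<phi> :: "real \<Rightarrow> real"
  assumes \<phi>: "continuous_on I \<phi>" and D: "D = {y \<in> I. \<phi> y = 0}" and \<omega>: "\<omega> \<in> space M"
    and fin: "entry_time X D \<omega> < \<infinity>"
  obtains s where "0 \<le> s" "entry_time X D \<omega> = ennreal s" "X s \<omega> \<in> D"
proof -
  define C where "C = {s \<in> {0..}. \<phi> (X s \<omega>) = 0}"
  have C_iff: "s \<in> C \<longleftrightarrow> 0 \<le> s \<and> X s \<omega> \<in> D" for s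
    using in_state_space[OF \<omega>, of s] unfolding C_def D by auto
  have "C = {0..} \<inter> (\<lambda>s. \<phi> (X s \<omega>)) -` {0}"
    by (auto simp: C_def)
  then have "closed C"
    using continuous_closed_preimage[OF continuous_path_image[OF \<phi> \<omega>] closed_atLeast closed_singleton]
    by simp
  moreover have "C \<noteq> {}"
  proof
    assume "C = {}"
    then have "{ennreal t | t. 0 \<le> t \<and> X t \<omega> \<in> D} = {}" using C_iff by blast
    then have "entry_time X D \<omega> = \<infinity>" unfolding entry_time_def by (simp only: Inf_empty infinity_ennreal_def)
    with fin show False by simp
  qed
  moreover have bdd: "bdd_below C" by (rule bdd_belowI[of _ 0]) (simp add: C_def)
  ultimately have InfC: "Inf C \<in> C" by (intro closed_contains_Inf)
  have "entry_time X D \<omega> = ennreal (Inf C)"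
    unfolding entry_time_def
  proof (rule antisym)
    show "Inf {ennreal t | t. 0 \<le> t \<and> X t \<omega> \<in> D} \<le> ennreal (Inf C)"
      using InfC C_iff by (intro Inf_lower) auto
    show "ennreal (Inf C) \<le> Inf {ennreal t | t. 0 \<le> t \<and> X t \<omega> \<in> D}"
    proof (rule Inf_greatest)
      fix u assume "u \<in> {ennreal t | t. 0 \<le> t \<and> X t \<omega> \<in> D}"
      then obtain t where "u = ennreal t" "t \<in> C" using C_iff by blast
      then show "ennreal (Inf C) \<le> u" using cInf_lower[OF _ bdd] by (simp add: ennreal_leI)
    qed
  qed
  then show thesis using that InfC C_iff by blast
qed

lemma entry_time_le_iff:
  fixes \<phi> :: "real \<Rightarrow> real"
  assumes \<phi>: "continuous_on I \<phi>" and D: "D = {y \<in> I. \<phi> y = 0}" and \<omega>: "\<omega> \<in> space M" and t: "0 \<le> t"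
  shows "entry_time X D \<omega> \<le> ennreal t \<longleftrightarrow> (\<exists>s\<in>{0..t}. \<phi> (X s \<omega>) = 0)"
proof
  assume le: "entry_time X D \<omega> \<le> ennreal t"
  then have "entry_time X D \<omega> < \<infinity>"
    unfolding infinity_ennreal_def by (rule le_less_trans) (rule ennreal_less_top)
  then obtain s where "0 \<le> s" "entry_time X D \<omega> = ennreal s" "X s \<omega> \<in> D"
    by (rule entry_time_attained[OF \<phi> D \<omega>])
  with le t D show "\<exists>s\<in>{0..t}. \<phi> (X s \<omega>) = 0" by auto
next
  assume "\<exists>s\<in>{0..t}. \<phi> (X s \<omega>) = 0"
  then obtain s where s: "0 \<le> s" "s \<le> t" "\<phi> (X s \<omega>) = 0" by auto
  then have "X s \<omega> \<in> D" using in_state_space[OF \<omega> s(1)] unfolding D by simp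
  then have "entry_time X D \<omega> \<le> ennreal s"
    unfolding entry_time_def using s by (intro Inf_lower) auto
  then show "entry_time X D \<omega> \<le> ennreal t"
    using s(2) by (meson ennreal_leI order_trans)
qed

text \<open>By compactness of the time interval, the path meets the zero set of \<open>\<phi>\<close> before \<open>t\<close> iff
  \<open>\<phi>\<close> becomes arbitrarily small along a countable dense set of times in \<open>{0..t}\<close>.\<close>

lemma entry_time_stopping_time:
  fixes \<phi> :: "real \<Rightarrow> real"
  assumes \<phi>: "continuous_on I \<phi>" and D: "D = {y \<in> I. \<phi> y = 0}" and t: "0 \<le> t"
  shows "{\<omega> \<in> space M. entry_time X D \<omega> \<le> ennreal t} \<in> sets (FX t)"
proof -
  define q where "q k m = min t (real k / real (Suc m))" for k m
  have q: "q k m \<in> {0..t}" for k m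
    using t by (auto simp: q_def)
  have meas: "(\<lambda>\<omega>. \<phi> (X (q k m) \<omega>)) \<in> borel_measurable (FX t)" for k m
  proof -
    have "(\<lambda>\<omega>. \<phi> (X (q k m) \<omega>)) \<in> borel_measurable (FX (q k m))"
      using q by (intro measurable_path_image[OF \<phi>]) auto
    moreover have "sets (FX (q k m)) \<subseteq> sets (FX t)"
      using q by (intro FX_mono) auto
    ultimately show ?thesis
      using measurable_from_subalg[of "FX t" "FX (q k m)"] by (auto simp: subalgebra_def)
  qed
  have "(\<exists>s\<in>{0..t}. \<phi> (X s \<omega>) = 0) \<longleftrightarrow>
      (\<forall>n::nat. \<exists>k m. \<bar>\<phi> (X (q k m) \<omega>)\<bar> < inverse (real (Suc n)))" if \<omega>: "\<omega> \<in> space M" for \<omega>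
  proof
    assume "\<exists>s\<in>{0..t}. \<phi> (X s \<omega>) = 0"
    then obtain s where s: "0 \<le> s" "s \<le> t" "\<phi> (X s \<omega>) = 0" by auto
    have "(\<lambda>m. q (nat \<lceil>s * real (Suc m)\<rceil>) m) \<longlonglongrightarrow> min t s"
      unfolding q_def by (intro tendsto_intros upper_approximation_tendsto s)
    then have "(\<lambda>m. \<phi> (X (q (nat \<lceil>s * real (Suc m)\<rceil>) m) \<omega>)) \<longlonglongrightarrow> \<phi> (X (min t s) \<omega>)"
      using q s t by (intro continuous_on_tendsto_compose[OF continuous_path_image[OF \<phi> \<omega>]]) auto
    then have lim: "(\<lambda>m. \<bar>\<phi> (X (q (nat \<lceil>s * real (Suc m)\<rceil>) m) \<omega>)\<bar>) \<longlonglongrightarrow> 0"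
      using s tendsto_rabs_zero[of "\<lambda>m. \<phi> (X (q (nat \<lceil>s * real (Suc m)\<rceil>) m) \<omega>)" sequentially]
      by (simp only: min_absorb2)
    show "\<forall>n::nat. \<exists>k m. \<bar>\<phi> (X (q k m) \<omega>)\<bar> < inverse (real (Suc n))"
    proof
      fix n
      have "eventually (\<lambda>m. \<bar>\<phi> (X (q (nat \<lceil>s * real (Suc m)\<rceil>) m) \<omega>)\<bar> < inverse (real (Suc n))) sequentially"
        by (rule order_tendstoD(2)[OF lim]) simp
      then show "\<exists>k m. \<bar>\<phi> (X (q k m) \<omega>)\<bar> < inverse (real (Suc n))"
        using eventually_happens'[OF sequentially_bot] by blast
    qed
  next
    assume small: "\<forall>n::nat. \<exists>k m. \<bar>\<phi> (X (q k m) \<omega>)\<bar> < inverse (real (Suc n))"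
    have "continuous_on {0..t} (\<lambda>s. \<bar>\<phi> (X s \<omega>)\<bar>)"
      by (intro continuous_on_rabs continuous_on_subset[OF continuous_path_image[OF \<phi> \<omega>]]) auto
    then obtain s where s: "s \<in> {0..t}" and min: "\<And>u. u \<in> {0..t} \<Longrightarrow> \<bar>\<phi> (X s \<omega>)\<bar> \<le> \<bar>\<phi> (X u \<omega>)\<bar>"
      using continuous_attains_inf[of "{0..t}"] t by fastforce
    have "\<phi> (X s \<omega>) = 0"
    proof (rule ccontr)
      assume "\<phi> (X s \<omega>) \<noteq> 0"
      then obtain n where "inverse (real (Suc n)) < \<bar>\<phi> (X s \<omega>)\<bar>"
        using reals_Archimedean[of "\<bar>\<phi> (X s \<omega>)\<bar>"] by auto
      moreover obtain k m where "\<bar>\<phi> (X (q k m) \<omega>)\<bar> < inverse (real (Suc n))"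
        using small by blast
      ultimately show False using min[OF q[of k m]] by linarith
    qed
    with s show "\<exists>s\<in>{0..t}. \<phi> (X s \<omega>) = 0" by blast
  qed
  then have "{\<omega> \<in> space M. entry_time X D \<omega> \<le> ennreal t} =
      {\<omega> \<in> space (FX t). \<forall>n::nat. \<exists>k m. \<bar>\<phi> (X (q k m) \<omega>)\<bar> < inverse (real (Suc n))}"
    using entry_time_le_iff[OF \<phi> D _ t] by auto
  also have "\<dots> \<in> sets (FX t)"
    using meas by measurable
  finally show ?thesis .
qed

text \<open>A first entry time is the randomised time whose intensity jumps from \<open>0\<close> to \<open>\<infinity>\<close> on entry, so
  that any positive level is reached at that moment.\<close>

lemma entry_time_admissible:
  fixes \<phi> :: "real \<Rightarrow> real"
  assumes \<phi>: "continuous_on I \<phi>" and D: "D = {y \<in> I. \<phi> y = 0}"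
    and pos: "\<And>\<omega>. \<omega> \<in> space M \<Longrightarrow> 0 < E \<omega>"
  shows "entry_time X D \<in> admissible_times M X E"
proof -
  define \<Psi> :: "real \<Rightarrow> 'w \<Rightarrow> ennreal" where
    "\<Psi> t \<omega> = (if entry_time X D \<omega> \<le> ennreal t then \<infinity> else 0)" for t \<omega>
  have "\<Psi> t \<in> borel_measurable (FX t)" if "0 \<le> t" for t
  proof -
    have "{\<omega> \<in> space (FX t). entry_time X D \<omega> \<le> ennreal t} \<in> sets (FX t)"
      using entry_time_stopping_time[OF \<phi> D that] by simp
    then show ?thesis unfolding \<Psi>_def by (intro measurable_If) auto
  qed
  then have "adapted FX \<Psi>" by (simp add: adapted_def)
  moreover have "mono_on {0..} (\<lambda>t. \<Psi> t \<omega>)" for \<omega>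
    by (rule mono_onI) (auto simp: \<Psi>_def dest: order_trans intro: ennreal_leI)
  moreover have "continuous (at_right t) (\<lambda>s. \<Psi> s \<omega>)" if t: "0 \<le> t" for t \<omega>
  proof (cases "entry_time X D \<omega> \<le> ennreal t")
    case True
    have "eventually (\<lambda>s. t < s) (at_right t)" by (simp add: eventually_at_right_less)
    then have "eventually (\<lambda>s. \<infinity> = \<Psi> s \<omega>) (at_right t)"
    proof eventually_elim
      case (elim s)
      then have "ennreal t \<le> ennreal s" by (simp add: ennreal_leI)
      with True show ?case by (simp add: \<Psi>_def)
    qed
    then have "((\<lambda>s. \<Psi> s \<omega>) \<longlongrightarrow> \<infinity>) (at_right t)"
      by (rule Lim_transform_eventually[OF tendsto_const])
    then show ?thesis using True by (simp add: continuous_within \<Psi>_def)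
  next
    case False
    then have "ennreal t < entry_time X D \<omega>" by simp
    then obtain b where b: "t < b" "ennreal b \<le> entry_time X D \<omega>"
    proof (cases "entry_time X D \<omega>")
      case (real c)
      then show ?thesis using that[of c] \<open>ennreal t < _\<close> t by (simp add: ennreal_less_iff)
    qed (use that[of "t + 1"] in simp)
    have "eventually (\<lambda>s. s < b) (at_right t)"
      using b(1) eventually_at_right_field by blast
    moreover have "eventually (\<lambda>s. t < s) (at_right t)" by (simp add: eventually_at_right_less)
    ultimately have "eventually (\<lambda>s. 0 = \<Psi> s \<omega>) (at_right t)"
    proof eventually_elim
      case (elim s)
      then have "ennreal s < ennreal b" using t by (simp add: ennreal_less_iff)
      then show ?case using b(2) by (auto simp: \<Psi>_def)
    qed
    then have "((\<lambda>s. \<Psi> s \<omega>) \<longlongrightarrow> 0) (at_right t)"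
      by (rule Lim_transform_eventually[OF tendsto_const])
    then show ?thesis using False by (simp add: continuous_within \<Psi>_def)
  qed
  moreover have "entry_time X D \<omega> = Inf {ennreal t | t. 0 \<le> t \<and> ennreal (E \<omega>) \<le> \<Psi> t \<omega>}"
    if "\<omega> \<in> space M" for \<omega>
  proof -
    have "ennreal (E \<omega>) \<le> \<Psi> t \<omega> \<longleftrightarrow> entry_time X D \<omega> \<le> ennreal t" for t
      using pos[OF that] by (auto simp: \<Psi>_def)
    then have "Inf {ennreal t | t. 0 \<le> t \<and> ennreal (E \<omega>) \<le> \<Psi> t \<omega>}
        = Inf {ennreal t | t. 0 \<le> t \<and> entry_time X D \<omega> \<le> ennreal t}" by simp
    also have "\<dots> = entry_time X D \<omega>"
    proof (cases "entry_time X D \<omega>")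
      case (real c)
      then show ?thesis by (intro antisym Inf_lower Inf_greatest) auto
    next
      case top
      then show ?thesis by (auto simp: top_unique)
    qed
    finally show ?thesis by simp
  qed
  ultimately show ?thesis unfolding admissible_times_def by blast
qed

lemma zero_admissible: "(\<lambda>_. 0) \<in> admissible_times M X E"
proof -
  have "(\<lambda>_. \<infinity>::ennreal) \<in> borel_measurable (FX t)" for t by simp
  moreover have "Inf {ennreal t | t. 0 \<le> t} = 0"
    by (rule antisym[OF Inf_lower]) (auto intro!: exI[of _ 0])
  ultimately show ?thesis
    unfolding admissible_times_def adapted_def
    by (intro CollectI exI[of _ "\<lambda>_ _. \<infinity>"]) (auto intro: mono_onI)
qed


section \<open>Optional stopping at randomised times\<close>

lemma supermartingale_set_integral_le:
  assumes super: "supermartingale M (extend_filtration M FX) Y"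
    and s: "0 \<le> s" "ennreal s \<le> t" and A: "A \<in> sets (FX s)"
  shows "(\<integral>\<omega>. indicator A \<omega> * (Y t \<omega> - Y (ennreal s) \<omega>) \<partial>M) \<le> 0"
proof -
  interpret FXs: finite_measure_subalgebra M "FX s"
    by unfold_locales (rule subalgebra_FX[OF s(1)])
  have Es: "extend_filtration M FX (ennreal s) = FX s"
    using s(1) by (simp add: extend_filtration_def)
  have int: "integrable M (Y u)" for u
    using super by (simp add: supermartingale_def)
  have A': "A \<in> sets M" using A FX_le_M[OF s(1)] by blast
  note ind = integrable_mult_indicator[OF A']
  have "AE \<omega> in M. real_cond_exp M (FX s) (Y t) \<omega> \<le> Y (ennreal s) \<omega>"
    using super s(2) Es unfolding supermartingale_def by metis
  then have "(\<integral>\<omega>. indicator A \<omega> *\<^sub>R real_cond_exp M (FX s) (Y t) \<omega> \<partial>M)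
      \<le> (\<integral>\<omega>. indicator A \<omega> *\<^sub>R Y (ennreal s) \<omega> \<partial>M)"
    by (intro integral_mono_AE ind FXs.real_cond_exp_int int) (auto elim!: eventually_mono simp: indicator_def)
  moreover have "(\<integral>\<omega>. indicator A \<omega> *\<^sub>R Y t \<omega> \<partial>M) = (\<integral>\<omega>. indicator A \<omega> *\<^sub>R real_cond_exp M (FX s) (Y t) \<omega> \<partial>M)"
    using FXs.real_cond_exp_intA[OF int A] by (simp add: set_lebesgue_integral_def)
  ultimately show ?thesis
    using Bochner_Integration.integral_diff[OF ind[OF int[of t]] ind[OF int[of "ennreal s"]]]
    by (simp add: right_diff_distrib)
qed

text \<open>Conditionally on \<open>E = u\<close>, which is independent of the process, the event \<open>\<Psi> < E\<close> becomes the
  event \<open>\<Psi> < u\<close> of \<open>FX s\<close>. This is Fubini's theorem for the product law of \<open>E\<close> and the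
  process.\<close>

lemma independent_level_integral_le:
  fixes E :: "'w \<Rightarrow> real" and \<Psi> :: "'w \<Rightarrow> ennreal" and Z :: "'w \<Rightarrow> real"
  assumes E [measurable]: "E \<in> borel_measurable M"
    and indep: "indep_set (sets (sigma_infinity M F)) (sets (vimage_algebra (space M) E borel))"
    and s: "0 \<le> s" and \<Psi>: "\<Psi> \<in> borel_measurable (FX s)"
    and Z: "Z \<in> borel_measurable (sigma_infinity M F)" "integrable M Z"
    and neg: "\<And>A. A \<in> sets (FX s) \<Longrightarrow> (\<integral>\<omega>. indicator A \<omega> * Z \<omega> \<partial>M) \<le> 0"
  shows "(\<integral>\<omega>. (if \<Psi> \<omega> < ennreal (E \<omega>) then 1 else 0) * Z \<omega> \<partial>M) \<le> 0"
proof -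
  define N where "N = sigma_infinity M F"
  define R where "R = distr M N (\<lambda>\<omega>. \<omega>)"
  have N_le_M: "sets N \<subseteq> sets M" and space_N: "space N = space M"
    using sigma_infinity_F_le_M by (simp_all add: N_def)
  then have id [measurable]: "(\<lambda>\<omega>. \<omega>) \<in> measurable M N"
    by (intro measurable_ident_sets[THEN measurable_from_subalg[rotated]]) (simp_all add: subalgebra_def)
  have FX_N: "sets (FX s) \<subseteq> sets N"
    using FX_le_F[OF s] filtration_le_sigma_infinity[OF s, of F] filtration_space[OF usual]
    unfolding N_def by blast
  then have \<Psi>N [measurable]: "\<Psi> \<in> borel_measurable N"
    using measurable_from_subalg[OF _ \<Psi>, of N] by (simp add: subalgebra_def N_def)
  have ZN [measurable]: "Z \<in> borel_measurable N" using Z(1) by (simp add: N_def)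
  interpret PE: prob_space "distr M borel E" by (rule prob_space_distr[OF E])
  interpret PR: prob_space R unfolding R_def by (rule prob_space_distr[OF id])
  interpret P: pair_sigma_finite "distr M borel E" R ..
  define \<phi> :: "real \<times> 'w \<Rightarrow> real" where
    "\<phi> = (\<lambda>(u, \<omega>). (if \<Psi> \<omega> < ennreal u then 1 else 0) * Z \<omega>)"
  have \<phi> [measurable]: "\<phi> \<in> borel_measurable (borel \<Otimes>\<^sub>M N)"
    unfolding \<phi>_def by measurable
  have pair [measurable]: "(\<lambda>\<omega>. (E \<omega>, \<omega>)) \<in> measurable M (borel \<Otimes>\<^sub>M N)"
    by (rule measurable_Pair[OF E id])
  have prod: "distr M borel E \<Otimes>\<^sub>M R = distr M (borel \<Otimes>\<^sub>M N) (\<lambda>\<omega>. (E \<omega>, \<omega>))"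
  proof (rule pair_measure_eqI)
    fix A B assume "A \<in> sets (distr M borel E)" "B \<in> sets R"
    then have A: "A \<in> sets borel" and B: "B \<in> sets N" by (simp_all add: R_def)
    have "E -` A \<inter> space M \<in> sets (vimage_algebra (space M) E borel)"
      by (rule in_vimage_algebra[OF A])
    then have "prob (B \<inter> (E -` A \<inter> space M)) = prob B * prob (E -` A \<inter> space M)"
      using indep_setD[OF indep] B unfolding N_def by blast
    moreover have "B \<subseteq> space M" using sets.sets_into_space[OF B] space_N by simp
    then have "(\<lambda>\<omega>. (E \<omega>, \<omega>)) -` (A \<times> B) \<inter> space M = B \<inter> (E -` A \<inter> space M)"
        "(\<lambda>\<omega>. \<omega>) -` B \<inter> space M = B" by auto
    ultimately show "emeasure (distr M borel E) A * emeasure R B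
        = emeasure (distr M (borel \<Otimes>\<^sub>M N) (\<lambda>\<omega>. (E \<omega>, \<omega>))) (A \<times> B)"
      using A B by (simp add: R_def emeasure_distr emeasure_eq_measure ennreal_mult[symmetric] mult.commute)
  qed (simp_all add: R_def PE.sigma_finite_measure_axioms PR.sigma_finite_measure_axioms[unfolded R_def] cong: sets_pair_measure_cong)
  have "integrable M (\<lambda>\<omega>. \<phi> (E \<omega>, \<omega>))"
    by (rule Bochner_Integration.integrable_bound[OF Z(2)]) (auto simp: \<phi>_def intro!: measurable_compose[OF pair \<phi>, unfolded \<phi>_def split_beta fst_conv snd_conv])
  then have "integrable (distr M borel E \<Otimes>\<^sub>M R) \<phi>"
    unfolding prod by (subst integrable_distr_eq[OF pair \<phi>])
  then have "(\<integral>u. (\<integral>\<omega>. \<phi> (u, \<omega>) \<partial>R) \<partial>distr M borel E) = integral\<^sup>L (distr M borel E \<Otimes>\<^sub>M R) \<phi>"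
    by (rule P.integral_fst')
  also have "\<dots> = (\<integral>\<omega>. \<phi> (E \<omega>, \<omega>) \<partial>M)"
    unfolding prod by (rule integral_distr[OF pair \<phi>])
  finally have fubini: "(\<integral>\<omega>. \<phi> (E \<omega>, \<omega>) \<partial>M) = (\<integral>u. (\<integral>\<omega>. \<phi> (u, \<omega>) \<partial>R) \<partial>distr M borel E)" ..
  have inner: "(\<integral>\<omega>. \<phi> (u, \<omega>) \<partial>R) \<le> 0" for u
  proof -
    have "(\<integral>\<omega>. \<phi> (u, \<omega>) \<partial>R) = (\<integral>\<omega>. \<phi> (u, \<omega>) \<partial>M)"
      unfolding R_def by (rule integral_distr[OF id]) (simp add: \<phi>_def)
    also have "\<dots> = (\<integral>\<omega>. indicator {\<omega> \<in> space (FX s). \<Psi> \<omega> < ennreal u} \<omega> * Z \<omega> \<partial>M)"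
      by (intro Bochner_Integration.integral_cong) (auto simp: \<phi>_def)
    also have "\<dots> \<le> 0"
    proof (rule neg)
      show "{\<omega> \<in> space (FX s). \<Psi> \<omega> < ennreal u} \<in> sets (FX s)"
        using \<Psi> by measurable
    qed
    finally show ?thesis .
  qed
  have "(\<integral>u. (\<integral>\<omega>. \<phi> (u, \<omega>) \<partial>R) \<partial>distr M borel E) \<le> 0"
    using integral_nonneg_AE[where M = "distr M borel E" and f = "\<lambda>u. - (\<integral>\<omega>. \<phi> (u, \<omega>) \<partial>R)"] inner
    by simp
  then show ?thesis unfolding fubini[symmetric] by (simp add: \<phi>_def)
qed

text \<open>By right continuity the infimum in the definition of a randomised time is attained, so that the time is
  at most \<open>t\<close> iff the level \<open>E\<close> has been reached by the time \<open>t\<close>.\<close>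

lemma admissible_time_le_iff:
  assumes \<tau>: "\<tau> \<in> admissible_times M X E"
  obtains \<Psi> :: "real \<Rightarrow> 'w \<Rightarrow> ennreal" where
    "\<And>t. 0 \<le> t \<Longrightarrow> \<Psi> t \<in> borel_measurable (FX t)"
    "\<And>t \<omega>. 0 \<le> t \<Longrightarrow> \<omega> \<in> space M \<Longrightarrow> \<tau> \<omega> \<le> ennreal t \<longleftrightarrow> ennreal (E \<omega>) \<le> \<Psi> t \<omega>"
proof -
  obtain \<Psi> :: "real \<Rightarrow> 'w \<Rightarrow> ennreal" where ad: "adapted FX \<Psi>"
    and path: "\<And>\<omega>. \<omega> \<in> space M \<Longrightarrow> mono_on {0..} (\<lambda>t. \<Psi> t \<omega>)"
      "\<And>\<omega> t. \<omega> \<in> space M \<Longrightarrow> 0 \<le> t \<Longrightarrow> continuous (at_right t) (\<lambda>s. \<Psi> s \<omega>)"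
      "\<And>\<omega>. \<omega> \<in> space M \<Longrightarrow> \<tau> \<omega> = Inf {ennreal t | t. 0 \<le> t \<and> ennreal (E \<omega>) \<le> \<Psi> t \<omega>}"
    using \<tau> unfolding admissible_times_def by blast
  have "\<tau> \<omega> \<le> ennreal t \<longleftrightarrow> ennreal (E \<omega>) \<le> \<Psi> t \<omega>" if t: "0 \<le> t" and \<omega>: "\<omega> \<in> space M" for t \<omega>
  proof
    assume "ennreal (E \<omega>) \<le> \<Psi> t \<omega>"
    then show "\<tau> \<omega> \<le> ennreal t"
      unfolding path(3)[OF \<omega>] using t by (intro Inf_lower) auto
  next
    assume le: "\<tau> \<omega> \<le> ennreal t"
    show "ennreal (E \<omega>) \<le> \<Psi> t \<omega>"
    proof (rule ccontr)
      assume "\<not> ?thesis"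
      then have less: "\<Psi> t \<omega> < ennreal (E \<omega>)" by simp
      have "((\<lambda>s. \<Psi> s \<omega>) \<longlongrightarrow> \<Psi> t \<omega>) (at_right t)"
        using path(2)[OF \<omega> t] by (simp add: continuous_within)
      then have "eventually (\<lambda>s. \<Psi> s \<omega> < ennreal (E \<omega>)) (at_right t)"
        using less by (rule order_tendstoD(2))
      then obtain b where b: "t < b" "\<And>s. t < s \<Longrightarrow> s < b \<Longrightarrow> \<Psi> s \<omega> < ennreal (E \<omega>)"
        unfolding eventually_at_right_field by blast
      have "ennreal b \<le> \<tau> \<omega>"
        unfolding path(3)[OF \<omega>]
      proof (rule Inf_greatest)
        fix u assume "u \<in> {ennreal t | t. 0 \<le> t \<and> ennreal (E \<omega>) \<le> \<Psi> t \<omega>}"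
        then obtain s where s: "u = ennreal s" "0 \<le> s" "ennreal (E \<omega>) \<le> \<Psi> s \<omega>" by blast
        have "b \<le> s"
        proof (rule ccontr)
          assume "\<not> b \<le> s"
          then consider "s \<le> t" | "t < s" "s < b" by linarith
          then show False
          proof cases
            case 1
            then have "\<Psi> s \<omega> \<le> \<Psi> t \<omega>" using mono_onD[OF path(1)[OF \<omega>]] s t by simp
            then show False using s(3) less by simp
          next
            case 2
            then show False using b(2)[OF 2] s(3) by simp
          qed
        qed
        then show "ennreal b \<le> u" by (simp add: s(1) ennreal_leI)
      qed
      then have "ennreal b \<le> ennreal t" using le by (rule order_trans)
      then show False using b(1) t by simp
    qed
  qed
  then show thesis using that ad unfolding adapted_def by blast
qed

lemma admissible_time_measurable:
  assumes \<tau>: "\<tau> \<in> admissible_times M X E" and E: "E \<in> borel_measurable M"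
  shows "\<tau> \<in> borel_measurable M"
proof -
  obtain \<Psi> :: "real \<Rightarrow> 'w \<Rightarrow> ennreal" where \<Psi>: "\<And>t. 0 \<le> t \<Longrightarrow> \<Psi> t \<in> borel_measurable (FX t)"
    and le: "\<And>t \<omega>. 0 \<le> t \<Longrightarrow> \<omega> \<in> space M \<Longrightarrow> \<tau> \<omega> \<le> ennreal t \<longleftrightarrow> ennreal (E \<omega>) \<le> \<Psi> t \<omega>"
    using admissible_time_le_iff[OF \<tau>] by blast
  show ?thesis
  proof (rule borel_measurableI_le)
    fix c :: ennreal
    show "{\<omega> \<in> space M. \<tau> \<omega> \<le> c} \<in> sets M"
    proof (cases c)
      case (real t)
      have "\<Psi> t \<in> borel_measurable M"
        by (rule measurable_FX_M[OF real(1) \<Psi>[OF real(1)]])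
      then have "{\<omega> \<in> space M. ennreal (E \<omega>) \<le> \<Psi> t \<omega>} \<in> sets M"
        using E by measurable
      also have "{\<omega> \<in> space M. ennreal (E \<omega>) \<le> \<Psi> t \<omega>} = {\<omega> \<in> space M. \<tau> \<omega> \<le> c}"
        using le[OF real(1)] real(2) by auto
      finally show ?thesis .
    qed simp
  qed
qed

text \<open>Replace \<open>\<tau>\<close> by the next point of a grid. The stopped value is then \<open>Y 0\<close> plus increments of \<open>Y\<close>
  over grid cells, the cell that starts at \<open>s\<close> being counted on the event \<open>s < \<tau>\<close>, that is, on
  \<open>\<Psi> s < E\<close>; so each term has mean at most \<open>0\<close>. As the mesh shrinks, continuity of the paths and the
  integrable envelope give convergence of the means. The last cell ends at infinity, which is where the
  supermartingale property on the closed time set enters.\<close>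

theorem optional_stopping_randomised:
  fixes Y :: "ennreal \<Rightarrow> 'w \<Rightarrow> real"
  assumes super: "supermartingale M (extend_filtration M FX) Y"
    and \<tau>: "\<tau> \<in> admissible_times M X E"
    and E: "E \<in> borel_measurable M"
    and indep: "indep_set (sets (sigma_infinity M F)) (sets (vimage_algebra (space M) E borel))"
    and cont: "\<And>\<omega>. \<omega> \<in> space M \<Longrightarrow> continuous_on {0..} (\<lambda>s. Y (ennreal s) \<omega>)"
    and dom: "integrable M H" "AE \<omega> in M. \<forall>t. \<bar>Y t \<omega>\<bar> \<le> H \<omega>"
  shows "(\<integral>\<omega>. Y (\<tau> \<omega>) \<omega> \<partial>M) \<le> (\<integral>\<omega>. Y 0 \<omega> \<partial>M)"
proof -
  have int: "integrable M (Y t)" for t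
    using super by (simp add: supermartingale_def)
  then have meas: "Y t \<in> borel_measurable M" for t
    by (rule borel_measurable_integrable)
  have measN: "Y t \<in> borel_measurable (sigma_infinity M F)" for t
  proof (rule measurable_from_subalg)
    show "subalgebra (sigma_infinity M F) (extend_filtration M FX t)"
      using extend_FX_le_sigma_infinity[of t] sigma_infinity_FX_le_F subalgebra_extend_FX[of t]
      by (simp add: subalgebra_def)
    show "Y t \<in> borel_measurable (extend_filtration M FX t)"
      using super by (simp add: supermartingale_def)
  qed
  have \<tau>m: "\<tau> \<in> borel_measurable M" by (rule admissible_time_measurable[OF \<tau> E])
  obtain \<Psi> :: "real \<Rightarrow> 'w \<Rightarrow> ennreal" where \<Psi>: "\<And>t. 0 \<le> t \<Longrightarrow> \<Psi> t \<in> borel_measurable (FX t)"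
    and le: "\<And>t \<omega>. 0 \<le> t \<Longrightarrow> \<omega> \<in> space M \<Longrightarrow> \<tau> \<omega> \<le> ennreal t \<longleftrightarrow> ennreal (E \<omega>) \<le> \<Psi> t \<omega>"
    using admissible_time_le_iff[OF \<tau>] by blast
  define S where "S n \<omega> = grid_sum n (\<lambda>t. Y t \<omega>) (\<tau> \<omega>)" for n \<omega>
  have step: "integrable M (\<lambda>\<omega>. (if grid n k < \<tau> \<omega> then 1 else 0) * (Y (grid n (Suc k)) \<omega> - Y (grid n k) \<omega>)) \<and>
      (\<integral>\<omega>. (if grid n k < \<tau> \<omega> then 1 else 0) * (Y (grid n (Suc k)) \<omega> - Y (grid n k) \<omega>) \<partial>M) \<le> 0"
    (is "integrable M ?f \<and> _") if k: "k \<le> Suc n * Suc n" for n k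
  proof -
    define s where "s = real k / real (Suc n)"
    have s: "0 \<le> s" and gs: "grid n k = ennreal s"
      using grid_finite[OF k] by (simp_all add: s_def)
    let ?Z = "\<lambda>\<omega>. Y (grid n (Suc k)) \<omega> - Y (ennreal s) \<omega>"
    have Zint: "integrable M ?Z" by (intro Bochner_Integration.integrable_diff int)
    have "integrable M ?f"
      unfolding gs using \<tau>m meas
      by (intro Bochner_Integration.integrable_bound[OF Zint]) (auto intro!: borel_measurable_times measurable_If borel_measurable_diff)
    moreover have "(\<integral>\<omega>. (if \<Psi> s \<omega> < ennreal (E \<omega>) then 1 else 0) * ?Z \<omega> \<partial>M) \<le> 0"
    proof (rule independent_level_integral_le[OF E indep s \<Psi>[OF s] _ Zint])
      show "?Z \<in> borel_measurable (sigma_infinity M F)"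
        by (intro borel_measurable_diff measN)
      have "ennreal s \<le> grid n (Suc k)" using grid_mono[of k "Suc k" n] gs by simp
      then show "(\<integral>\<omega>. indicator A \<omega> * ?Z \<omega> \<partial>M) \<le> 0" if "A \<in> sets (FX s)" for A
        by (rule supermartingale_set_integral_le[OF super s _ that])
    qed
    moreover have "(\<integral>\<omega>. ?f \<omega> \<partial>M) = (\<integral>\<omega>. (if \<Psi> s \<omega> < ennreal (E \<omega>) then 1 else 0) * ?Z \<omega> \<partial>M)"
    proof (rule Bochner_Integration.integral_cong[OF refl])
      fix \<omega> assume "\<omega> \<in> space M"
      then have "ennreal s < \<tau> \<omega> \<longleftrightarrow> \<Psi> s \<omega> < ennreal (E \<omega>)"
        using le[OF s, of \<omega>] by (metis not_le)
      then show "?f \<omega> = (if \<Psi> s \<omega> < ennreal (E \<omega>) then 1 else 0) * ?Z \<omega>"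
        unfolding gs by simp
    qed
    ultimately show ?thesis by simp
  qed
  have S_le: "integral\<^sup>L M (S n) \<le> integral\<^sup>L M (Y 0)" for n
  proof -
    let ?d = "\<lambda>k \<omega>. (if grid n k < \<tau> \<omega> then 1 else 0) * (Y (grid n (Suc k)) \<omega> - Y (grid n k) \<omega>)"
    let ?K = "{..Suc n * Suc n}"
    have d: "integrable M (?d k)" "integral\<^sup>L M (?d k) \<le> 0" if "k \<in> ?K" for k
      using step[of k n] that by blast+
    have "S n = (\<lambda>\<omega>. Y 0 \<omega> + (\<Sum>k\<in>?K. ?d k \<omega>))"
      by (rule ext) (simp only: S_def grid_sum_def)
    then have "integral\<^sup>L M (S n) = (\<integral>\<omega>. Y 0 \<omega> + (\<Sum>k\<in>?K. ?d k \<omega>) \<partial>M)"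
      by (rule arg_cong)
    also have "\<dots> = integral\<^sup>L M (Y 0) + (\<integral>\<omega>. (\<Sum>k\<in>?K. ?d k \<omega>) \<partial>M)"
      by (rule Bochner_Integration.integral_add[OF int Bochner_Integration.integrable_sum[OF d(1)]])
    also have "(\<integral>\<omega>. (\<Sum>k\<in>?K. ?d k \<omega>) \<partial>M) = (\<Sum>k\<in>?K. integral\<^sup>L M (?d k))"
      by (rule Bochner_Integration.integral_sum[OF d(1)])
    also have "\<dots> \<le> 0" by (rule sum_nonpos[OF d(2)])
    finally show ?thesis by simp
  qed
  have "(\<lambda>n. integral\<^sup>L M (S n)) \<longlonglongrightarrow> (\<integral>\<omega>. Y (\<tau> \<omega>) \<omega> \<partial>M)"
  proof (rule integral_dominated_convergence[where w = H])
    show "(\<lambda>\<omega>. Y (\<tau> \<omega>) \<omega>) \<in> borel_measurable M"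
      by (rule measurable_at_random_time[OF meas \<tau>m cont])
    show "S n \<in> borel_measurable M" for n
      unfolding S_def by (rule measurable_grid_sum[OF meas \<tau>m])
    show "AE \<omega> in M. (\<lambda>n. S n \<omega>) \<longlonglongrightarrow> Y (\<tau> \<omega>) \<omega>"
      using cont by (auto simp: S_def intro!: AE_I2 grid_sum_tendsto)
    show "AE \<omega> in M. norm (S n \<omega>) \<le> H \<omega>" for n
      using dom(2) by eventually_elim (simp add: S_def grid_sum_bound)
  qed (rule dom(1))
  then show ?thesis
    by (rule LIMSEQ_le_const2) (use S_le in blast)
qed

lemma supermartingale_uminus:
  assumes sub: "submartingale M (extend_filtration M FX) Y"
  shows "supermartingale M (extend_filtration M FX) (\<lambda>t \<omega>. - Y t \<omega>)"
  unfolding supermartingale_def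
proof (intro conjI allI impI)
  fix s t :: ennreal
  show "(\<lambda>\<omega>. - Y t \<omega>) \<in> borel_measurable (extend_filtration M FX t)" "integrable M (\<lambda>\<omega>. - Y t \<omega>)"
    using sub by (simp_all add: submartingale_def)
  assume st: "s \<le> t"
  interpret Es: finite_measure_subalgebra M "extend_filtration M FX s"
    by unfold_locales (rule subalgebra_extend_FX)
  have int: "integrable M (Y t)" using sub by (simp add: submartingale_def)
  have "AE \<omega> in M. Y s \<omega> \<le> real_cond_exp M (extend_filtration M FX s) (Y t) \<omega>"
    using sub st by (simp add: submartingale_def)
  moreover have "AE \<omega> in M. real_cond_exp M (extend_filtration M FX s) (\<lambda>\<omega>. - 1 * Y t \<omega>) \<omega>
      = - 1 * real_cond_exp M (extend_filtration M FX s) (Y t) \<omega>"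
    by (rule Es.real_cond_exp_cmult[OF int])
  ultimately show "AE \<omega> in M. real_cond_exp M (extend_filtration M FX s) (\<lambda>\<omega>. - Y t \<omega>) \<omega> \<le> - Y s \<omega>"
    by eventually_elim simp
qed

text \<open>Continuity of the paths reduces each supremum over time to a countable one. This makes the suprema
  measurable, so that finiteness of the integral yields an integrable real-valued bound.\<close>

lemma envelope_exists:
  assumes cont: "continuous_on I f" "continuous_on I g" "continuous_on I h"
    and fin: "(\<integral>\<^sup>+\<omega>. (SUP t\<in>{0..}. ennreal (exp (- r * t) * \<bar>f (X t \<omega>)\<bar>))
          + (SUP t\<in>{0..}. ennreal (exp (- r * t) * \<bar>g (X t \<omega>)\<bar>))
          + (SUP t\<in>{0..}. ennreal (exp (- r * t) * \<bar>h (X t \<omega>)\<bar>)) \<partial>M) < \<infinity>"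
  shows "\<exists>H. integrable M H \<and>
    (AE \<omega> in M. \<forall>t\<ge>0. exp (- r * t) * (\<bar>f (X t \<omega>)\<bar> + \<bar>g (X t \<omega>)\<bar> + \<bar>h (X t \<omega>)\<bar>) \<le> H \<omega>)"
proof -
  let ?s = "\<lambda>w \<omega>. SUP t\<in>{0..}. ennreal (exp (- r * t) * \<bar>w (X t \<omega>)\<bar>)"
  define S where "S \<omega> = ?s f \<omega> + ?s g \<omega> + ?s h \<omega>" for \<omega>
  have meas: "?s w \<in> borel_measurable M" if w: "continuous_on I w" for w :: "real \<Rightarrow> real"
  proof (subst measurable_cong)
    fix \<omega> assume "\<omega> \<in> space M"
    then have "continuous_on {0..} (\<lambda>t. exp (- r * t) * \<bar>w (X t \<omega>)\<bar>)"
      by (intro continuous_intros continuous_path_image[OF w])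
    then show "?s w \<omega> = (SUP k::nat. SUP m::nat.
        ennreal (exp (- r * (real k / real (Suc m))) * \<bar>w (X (real k / real (Suc m)) \<omega>)\<bar>))"
      by (rule SUP_continuous_eq_SUP_rational)
  next
    have [measurable]: "(\<lambda>\<omega>. w (X (real k / real (Suc m)) \<omega>)) \<in> borel_measurable M" for k m :: nat
      by (rule measurable_FX_M[OF _ measurable_path_image[OF w]]) simp_all
    show "(\<lambda>\<omega>. SUP k::nat. SUP m::nat.
        ennreal (exp (- r * (real k / real (Suc m))) * \<bar>w (X (real k / real (Suc m)) \<omega>)\<bar>)) \<in> borel_measurable M"
      by measurable
  qed
  have Sm [measurable]: "S \<in> borel_measurable M"
    unfolding S_def by (intro borel_measurable_add meas cont)
  have Sfin: "(\<integral>\<^sup>+\<omega>. S \<omega> \<partial>M) < \<infinity>" using fin by (simp add: S_def)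
  have "integrable M (\<lambda>\<omega>. enn2real (S \<omega>))"
  proof (rule integrableI_bounded)
    have "(\<integral>\<^sup>+\<omega>. ennreal (norm (enn2real (S \<omega>))) \<partial>M) \<le> (\<integral>\<^sup>+\<omega>. S \<omega> \<partial>M)"
      by (intro nn_integral_mono) (simp add: ennreal_enn2real_if)
    then show "(\<integral>\<^sup>+\<omega>. ennreal (norm (enn2real (S \<omega>))) \<partial>M) < \<infinity>"
      using Sfin by (rule le_less_trans)
  qed simp
  moreover have "AE \<omega> in M. S \<omega> \<noteq> \<infinity>"
    using Sfin by (intro nn_integral_PInf_AE) auto
  then have "AE \<omega> in M. \<forall>t\<ge>0. exp (- r * t) * (\<bar>f (X t \<omega>)\<bar> + \<bar>g (X t \<omega>)\<bar> + \<bar>h (X t \<omega>)\<bar>) \<le> enn2real (S \<omega>)"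
  proof eventually_elim
    case (elim \<omega>)
    show ?case
    proof (intro allI impI)
      fix t :: real assume t: "0 \<le> t"
      have "ennreal (exp (- r * t) * \<bar>w (X t \<omega>)\<bar>) \<le> ?s w \<omega>" for w
        using t by (intro SUP_upper) simp
      then have "ennreal (exp (- r * t) * \<bar>f (X t \<omega>)\<bar>) + ennreal (exp (- r * t) * \<bar>g (X t \<omega>)\<bar>)
          + ennreal (exp (- r * t) * \<bar>h (X t \<omega>)\<bar>) \<le> S \<omega>"
        unfolding S_def by (intro add_mono)
      then have "ennreal (exp (- r * t) * (\<bar>f (X t \<omega>)\<bar> + \<bar>g (X t \<omega>)\<bar> + \<bar>h (X t \<omega>)\<bar>)) \<le> S \<omega>"
        by (simp add: distrib_left ennreal_plus[symmetric] del: ennreal_plus)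
      from enn2real_mono[OF this] elim
      show "exp (- r * t) * (\<bar>f (X t \<omega>)\<bar> + \<bar>g (X t \<omega>)\<bar> + \<bar>h (X t \<omega>)\<bar>) \<le> enn2real (S \<omega>)"
        by (simp add: less_top)
    qed
  qed
  ultimately show ?thesis by blast
qed

end

lemma discounted_0 [simp]: "discounted r w \<gamma> 0 = w (\<gamma> 0)"
  by (simp add: discounted_def)

lemma discounted_mono:
  "(\<tau> \<noteq> \<infinity> \<Longrightarrow> u (\<gamma> (enn2real \<tau>)) \<le> w (\<gamma> (enn2real \<tau>))) \<Longrightarrow> discounted r u \<gamma> \<tau> \<le> discounted r w \<gamma> \<tau>"
  by (simp add: discounted_def)


section \<open>Discounted payoffs below an integrable envelope\<close>

locale dominated_process = continuous_adapted_process M F X I x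
  for M :: "'w measure" and F :: "real \<Rightarrow> 'w measure" and X :: "real \<Rightarrow> 'w \<Rightarrow> real"
    and I :: "real set" and x :: real +
  fixes r :: real and p :: "real \<Rightarrow> real" and H :: "'w \<Rightarrow> real"
  assumes envelope_nonneg: "\<And>y. 0 \<le> p y"
    and envelope_integrable: "integrable M H"
    and envelope: "AE \<omega> in M. \<forall>t\<ge>0. exp (- r * t) * p (X t \<omega>) \<le> H \<omega>"
begin

abbreviation disc :: "(real \<Rightarrow> real) \<Rightarrow> ennreal \<Rightarrow> 'w \<Rightarrow> real" where
  "disc w \<tau> \<omega> \<equiv> discounted r w (\<lambda>t. X t \<omega>) \<tau>"

lemma disc_bound:
  assumes w: "\<And>y. y \<in> I \<Longrightarrow> \<bar>w y\<bar> \<le> p y"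
  shows "AE \<omega> in M. \<forall>t. \<bar>disc w t \<omega>\<bar> \<le> H \<omega>"
  using envelope AE_space
proof eventually_elim
  case (elim \<omega>)
  have "0 \<le> exp (- r * 0) * p (X 0 \<omega>)" by (simp add: envelope_nonneg)
  also have "\<dots> \<le> H \<omega>" using elim(1) by (rule allE[of _ 0]) simp
  finally have H: "0 \<le> H \<omega>" .
  show ?case
  proof
    fix t
    show "\<bar>disc w t \<omega>\<bar> \<le> H \<omega>"
    proof (cases "t = \<infinity>")
      case False
      let ?s = "enn2real t"
      have "\<bar>disc w t \<omega>\<bar> = exp (- r * ?s) * \<bar>w (X ?s \<omega>)\<bar>"
        using False by (simp add: discounted_def abs_mult)
      also have "\<dots> \<le> exp (- r * ?s) * p (X ?s \<omega>)"
        using w[OF in_state_space[OF elim(2), of ?s]] by (intro mult_left_mono) simp_all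
      also have "\<dots> \<le> H \<omega>" using elim(1) enn2real_nonneg by blast
      finally show ?thesis .
    qed (simp add: discounted_def H)
  qed
qed

lemma disc_measurable:
  assumes w: "continuous_on I w"
  shows "disc w t \<in> borel_measurable M"
proof (cases "t = \<infinity>")
  case False
  have [measurable]: "(\<lambda>\<omega>. w (X (enn2real t) \<omega>)) \<in> borel_measurable M"
    by (rule measurable_FX_M[OF _ measurable_path_image[OF w]]) simp_all
  show ?thesis using False unfolding discounted_def by simp
qed (simp add: discounted_def)

lemma disc_continuous:
  assumes w: "continuous_on I w" and \<omega>: "\<omega> \<in> space M"
  shows "continuous_on {0..} (\<lambda>s. disc w (ennreal s) \<omega>)"
proof -
  have "continuous_on {0..} (\<lambda>s. exp (- r * s) * w (X s \<omega>))"
    by (intro continuous_intros continuous_path_image[OF w \<omega>])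
  then show ?thesis
    by (rule continuous_on_eq) (simp add: discounted_def)
qed

lemma disc_integrable:
  assumes w: "continuous_on I w" "\<And>y. y \<in> I \<Longrightarrow> \<bar>w y\<bar> \<le> p y" and \<tau>: "\<tau> \<in> borel_measurable M"
  shows "integrable M (\<lambda>\<omega>. disc w (\<tau> \<omega>) \<omega>)"
proof (rule Bochner_Integration.integrable_bound[OF envelope_integrable])
  show "(\<lambda>\<omega>. disc w (\<tau> \<omega>) \<omega>) \<in> borel_measurable M"
    by (rule measurable_at_random_time[OF disc_measurable[OF w(1)] \<tau> disc_continuous[OF w(1)]])
  have "AE \<omega> in M. \<forall>t. \<bar>disc w t \<omega>\<bar> \<le> H \<omega>"
    by (rule disc_bound) (rule w(2))
  then show "AE \<omega> in M. norm (disc w (\<tau> \<omega>) \<omega>) \<le> norm (H \<omega>)"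
    by eventually_elim (metis order_trans abs_ge_self real_norm_def)
qed

lemma stopped_continuous:
  assumes w: "continuous_on I w" and \<omega>: "\<omega> \<in> space M"
  shows "continuous_on {0..} (\<lambda>s. stopped_discounted r w X \<sigma> (ennreal s) \<omega>)"
proof (cases "\<sigma> \<omega>")
  case (real a)
  have "continuous_on {0..} (\<lambda>s. disc w (ennreal (min s a)) \<omega>)"
    by (rule continuous_on_compose2[OF disc_continuous[OF w \<omega>]])
      (use real in \<open>auto intro!: continuous_intros\<close>)
  then show ?thesis
    by (rule continuous_on_eq) (use real in \<open>simp add: stopped_discounted_def min_def\<close>)
next
  case top
  then show ?thesis using disc_continuous[OF w \<omega>] by (simp add: stopped_discounted_def)
qed

lemma stopped_start: "\<omega> \<in> space M \<Longrightarrow> stopped_discounted r w X \<sigma> 0 \<omega> = w x"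
  by (simp add: stopped_discounted_def start)

end


section \<open>Verification for a game with ordered payoffs\<close>

text \<open>A zero-sum game started at \<open>x\<close> in which the maximiser receives \<open>u\<close> by stopping first, \<open>v\<close> if
  the opponent stops first, and, because of \<open>tie\<close>, \<open>u\<close> again on simultaneous stopping.\<close>

locale ordered_stopping_game = dominated_process M F X I x r p H
  for M :: "'w measure" and F :: "real \<Rightarrow> 'w measure" and X :: "real \<Rightarrow> 'w \<Rightarrow> real"
    and I :: "real set" and x :: real and r :: real and p :: "real \<Rightarrow> real" and H :: "'w \<Rightarrow> real" +
  fixes u v w :: "real \<Rightarrow> real" and E1 E2 :: "'w \<Rightarrow> real"
  assumes start_in: "x \<in> I"
    and payoffs_continuous: "continuous_on I u" "continuous_on I v" "continuous_on I w"
    and payoffs_bounded: "\<And>y. y \<in> I \<Longrightarrow> \<bar>u y\<bar> \<le> p y" "\<And>y. y \<in> I \<Longrightarrow> \<bar>v y\<bar> \<le> p y"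
    and ordered: "\<And>y. y \<in> I \<Longrightarrow> u y \<le> v y"
    and tie: "\<And>y. y \<in> I \<Longrightarrow> w y = u y"
    and E1: "E1 \<in> borel_measurable M" "\<And>\<omega>. \<omega> \<in> space M \<Longrightarrow> 0 < E1 \<omega>"
      "indep_set (sets (sigma_infinity M F)) (sets (vimage_algebra (space M) E1 borel))"
    and E2: "E2 \<in> borel_measurable M" "\<And>\<omega>. \<omega> \<in> space M \<Longrightarrow> 0 < E2 \<omega>"
      "indep_set (sets (sigma_infinity M F)) (sets (vimage_algebra (space M) E2 borel))"
begin

abbreviation J :: "('w \<Rightarrow> ennreal) \<Rightarrow> ('w \<Rightarrow> ennreal) \<Rightarrow> real" where
  "J \<equiv> game_payoff r u v w M X"

abbreviation outcome :: "('w \<Rightarrow> ennreal) \<Rightarrow> ('w \<Rightarrow> ennreal) \<Rightarrow> 'w \<Rightarrow> real" where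
  "outcome \<tau>1 \<tau>2 \<omega> \<equiv> (if \<tau>1 \<omega> < \<tau>2 \<omega> then disc u (\<tau>1 \<omega>) \<omega>
     else if \<tau>2 \<omega> < \<tau>1 \<omega> then disc v (\<tau>2 \<omega>) \<omega> else disc w (\<tau>1 \<omega>) \<omega>)"

text \<open>The Bochner integral of a non-integrable function is \<open>0\<close>, so no comparison of payoffs is possible
  before the outcome is known to be integrable.\<close>

lemma outcome_integrable:
  assumes [measurable]: "\<tau>1 \<in> borel_measurable M" "\<tau>2 \<in> borel_measurable M"
  shows "integrable M (outcome \<tau>1 \<tau>2)"
proof -
  have int: "integrable M (\<lambda>\<omega>. disc u (\<tau>1 \<omega>) \<omega>)" "integrable M (\<lambda>\<omega>. disc v (\<tau>2 \<omega>) \<omega>)"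
      "integrable M (\<lambda>\<omega>. disc w (\<tau>1 \<omega>) \<omega>)"
    by (intro disc_integrable; use payoffs_continuous payoffs_bounded tie in simp)+
  note int[THEN borel_measurable_integrable, measurable]
  show ?thesis
  proof (rule Bochner_Integration.integrable_bound)
    show "integrable M (\<lambda>\<omega>. \<bar>disc u (\<tau>1 \<omega>) \<omega>\<bar> + \<bar>disc v (\<tau>2 \<omega>) \<omega>\<bar> + \<bar>disc w (\<tau>1 \<omega>) \<omega>\<bar>)"
      by (intro Bochner_Integration.integrable_add integrable_abs int)
    show "AE \<omega> in M. norm (outcome \<tau>1 \<tau>2 \<omega>)
        \<le> norm (\<bar>disc u (\<tau>1 \<omega>) \<omega>\<bar> + \<bar>disc v (\<tau>2 \<omega>) \<omega>\<bar> + \<bar>disc w (\<tau>1 \<omega>) \<omega>\<bar>)"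
      by (rule AE_I2) auto
  qed measurable
qed

lemma payoff_stop_at_once_1: "J (\<lambda>_. 0) \<tau>2 = u x"
proof -
  have "J (\<lambda>_. 0) \<tau>2 = (\<integral>\<omega>. u x \<partial>M)"
    unfolding game_payoff_def
    by (intro Bochner_Integration.integral_cong) (auto simp: start tie start_in)
  then show ?thesis by (simp add: prob_space)
qed

lemma payoff_stop_at_once_2:
  assumes \<tau>1: "\<tau>1 \<in> admissible_times M X E1"
  shows "J \<tau>1 (\<lambda>_. 0) \<le> v x"
proof -
  have "J \<tau>1 (\<lambda>_. 0) \<le> (\<integral>\<omega>. v x \<partial>M)"
    unfolding game_payoff_def
  proof (rule integral_mono[OF outcome_integrable])
    show "\<tau>1 \<in> borel_measurable M" by (rule admissible_time_measurable[OF \<tau>1 E1(1)])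
    show "outcome \<tau>1 (\<lambda>_. 0) \<omega> \<le> v x" if "\<omega> \<in> space M" for \<omega>
      using that by (auto simp: start tie start_in ordered)
  qed simp_all
  then show ?thesis by (simp add: prob_space)
qed

context
  fixes U :: "real \<Rightarrow> real" and D1 D2 :: "real set"
  assumes U_continuous: "continuous_on I U"
    and D1: "D1 = {y \<in> I. u y = U y}" and D2: "D2 = {y \<in> I. v y = U y}"
    and between: "\<And>y. y \<in> I \<Longrightarrow> u y \<le> U y \<and> U y \<le> v y"
begin

lemma U_bounded: "y \<in> I \<Longrightarrow> \<bar>U y\<bar> \<le> p y"
  using payoffs_bounded[of y] between[of y] by linarith

lemma D1_zero: "continuous_on I (\<lambda>y. u y - U y)" "D1 = {y \<in> I. u y - U y = 0}"
  by (intro continuous_intros payoffs_continuous U_continuous) (simp add: D1)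

lemma D2_zero: "continuous_on I (\<lambda>y. v y - U y)" "D2 = {y \<in> I. v y - U y = 0}"
  by (intro continuous_intros payoffs_continuous U_continuous) (simp add: D2)

lemma entry_admissible:
  "entry_time X D1 \<in> admissible_times M X E1" "entry_time X D2 \<in> admissible_times M X E2"
  by (rule entry_time_admissible[OF D1_zero E1(2)] entry_time_admissible[OF D2_zero E2(2)]; assumption)+

lemma state_at_entry_1:
  assumes "\<omega> \<in> space M" "entry_time X D1 \<omega> \<noteq> \<infinity>"
  shows "X (enn2real (entry_time X D1 \<omega>)) \<omega> \<in> D1"
  by (rule entry_time_attained[OF D1_zero assms(1)]) (use assms(2) in \<open>simp_all add: less_top\<close>)

lemma state_at_entry_2:
  assumes "\<omega> \<in> space M" "entry_time X D2 \<omega> \<noteq> \<infinity>"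
  shows "X (enn2real (entry_time X D2 \<omega>)) \<omega> \<in> D2"
  by (rule entry_time_attained[OF D2_zero assms(1)]) (use assms(2) in \<open>simp_all add: less_top\<close>)

lemma stopped_dominated:
  "AE \<omega> in M. \<forall>t. \<bar>stopped_discounted r U X \<sigma> t \<omega>\<bar> \<le> H \<omega>"
proof -
  have "AE \<omega> in M. \<forall>t. \<bar>disc U t \<omega>\<bar> \<le> H \<omega>"
    by (rule disc_bound) (rule U_bounded)
  then show ?thesis by eventually_elim (simp add: stopped_discounted_def)
qed

text \<open>The maximiser collects at most \<open>U\<close> by stopping first or by a tie, and at the entry into \<open>D2\<close> the
  payoff \<open>v\<close> equals \<open>U\<close>. The outcome is therefore at most the supermartingale evaluated at \<open>\<tau>1\<close>, whose
  mean is at most its initial value. If neither player ever stops, both sides are \<open>0\<close> by convention.\<close>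

lemma entry_D2_guarantees_minimiser:
  assumes super: "supermartingale M (extend_filtration M FX) (stopped_discounted r U X (entry_time X D2))"
    and \<tau>1: "\<tau>1 \<in> admissible_times M X E1"
  shows "J \<tau>1 (entry_time X D2) \<le> U x"
proof -
  let ?\<sigma> = "entry_time X D2"
  have m: "\<tau>1 \<in> borel_measurable M" "?\<sigma> \<in> borel_measurable M"
    by (rule admissible_time_measurable[OF \<tau>1 E1(1)] admissible_time_measurable[OF entry_admissible(2) E2(1)])+
  have "J \<tau>1 ?\<sigma> \<le> (\<integral>\<omega>. stopped_discounted r U X ?\<sigma> (\<tau>1 \<omega>) \<omega> \<partial>M)"
    unfolding game_payoff_def
  proof (rule integral_mono[OF outcome_integrable[OF m]])
    show "integrable M (\<lambda>\<omega>. stopped_discounted r U X ?\<sigma> (\<tau>1 \<omega>) \<omega>)"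
      unfolding stopped_discounted_def
      using disc_integrable[OF U_continuous U_bounded borel_measurable_min[OF m(2,1)]] by simp
    fix \<omega> assume \<omega>: "\<omega> \<in> space M"
    have in_I: "X (enn2real t) \<omega> \<in> I" for t by (rule in_state_space[OF \<omega>]) simp
    consider "\<tau>1 \<omega> < ?\<sigma> \<omega>" | "?\<sigma> \<omega> < \<tau>1 \<omega>" | "\<tau>1 \<omega> = ?\<sigma> \<omega>" by (rule linorder_cases)
    then show "outcome \<tau>1 ?\<sigma> \<omega> \<le> stopped_discounted r U X ?\<sigma> (\<tau>1 \<omega>) \<omega>"
    proof cases
      case 1
      have "disc u (\<tau>1 \<omega>) \<omega> \<le> disc U (\<tau>1 \<omega>) \<omega>"
        by (rule discounted_mono) (simp add: between[OF in_I])
      with 1 show ?thesis by (simp add: stopped_discounted_def)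
    next
      case 2
      then have "X (enn2real (?\<sigma> \<omega>)) \<omega> \<in> D2" by (intro state_at_entry_2[OF \<omega>]) auto
      then have "disc v (?\<sigma> \<omega>) \<omega> \<le> disc U (?\<sigma> \<omega>) \<omega>"
        by (intro discounted_mono) (simp add: D2)
      with 2 show ?thesis by (auto simp: stopped_discounted_def)
    next
      case 3
      have "disc w (\<tau>1 \<omega>) \<omega> \<le> disc U (\<tau>1 \<omega>) \<omega>"
        by (rule discounted_mono) (simp add: tie[OF in_I] between[OF in_I])
      with 3 show ?thesis by (simp add: stopped_discounted_def)
    qed
  qed
  also have "\<dots> \<le> (\<integral>\<omega>. stopped_discounted r U X ?\<sigma> 0 \<omega> \<partial>M)"
    by (rule optional_stopping_randomised[OF super \<tau>1 E1(1) E1(3) stopped_continuous[OF U_continuous]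
        envelope_integrable stopped_dominated])
  also have "\<dots> = (\<integral>\<omega>. U x \<partial>M)"
    by (rule Bochner_Integration.integral_cong) (simp_all add: stopped_start)
  finally show ?thesis by (simp add: prob_space)
qed

text \<open>The argument mirrors the one for the minimiser, except for ties: a tie pays \<open>u\<close>, which reaches \<open>U\<close>
  because a tie at a finite time takes place on \<open>D1\<close>.\<close>

lemma entry_D1_guarantees_maximiser:
  assumes sub: "submartingale M (extend_filtration M FX) (stopped_discounted r U X (entry_time X D1))"
    and \<tau>2: "\<tau>2 \<in> admissible_times M X E2"
  shows "U x \<le> J (entry_time X D1) \<tau>2"
proof -
  let ?\<sigma> = "entry_time X D1"
  have m: "?\<sigma> \<in> borel_measurable M" "\<tau>2 \<in> borel_measurable M"
    by (rule admissible_time_measurable[OF \<tau>2 E2(1)] admissible_time_measurable[OF entry_admissible(1) E1(1)])+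
  have "(\<integral>\<omega>. - stopped_discounted r U X ?\<sigma> (\<tau>2 \<omega>) \<omega> \<partial>M)
      \<le> (\<integral>\<omega>. - stopped_discounted r U X ?\<sigma> 0 \<omega> \<partial>M)"
  proof (rule optional_stopping_randomised[OF supermartingale_uminus[OF sub] \<tau>2 E2(1) E2(3) _ envelope_integrable])
    show "continuous_on {0..} (\<lambda>s. - stopped_discounted r U X ?\<sigma> (ennreal s) \<omega>)" if "\<omega> \<in> space M" for \<omega>
      by (rule continuous_on_minus[OF stopped_continuous[OF U_continuous that]])
    show "AE \<omega> in M. \<forall>t. \<bar>- stopped_discounted r U X ?\<sigma> t \<omega>\<bar> \<le> H \<omega>"
      using stopped_dominated by simp
  qed
  also have "\<dots> = (\<integral>\<omega>. - U x \<partial>M)"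
    by (rule Bochner_Integration.integral_cong) (simp_all add: stopped_start)
  finally have "U x \<le> (\<integral>\<omega>. stopped_discounted r U X ?\<sigma> (\<tau>2 \<omega>) \<omega> \<partial>M)"
    by (simp add: prob_space)
  also have "\<dots> \<le> J ?\<sigma> \<tau>2"
    unfolding game_payoff_def
  proof (rule integral_mono[OF _ outcome_integrable[OF m]])
    show "integrable M (\<lambda>\<omega>. stopped_discounted r U X ?\<sigma> (\<tau>2 \<omega>) \<omega>)"
      unfolding stopped_discounted_def
      using disc_integrable[OF U_continuous U_bounded borel_measurable_min[OF m]] by simp
    fix \<omega> assume \<omega>: "\<omega> \<in> space M"
    have in_I: "X (enn2real t) \<omega> \<in> I" for t by (rule in_state_space[OF \<omega>]) simp
    have entry: "disc U (?\<sigma> \<omega>) \<omega> \<le> disc u (?\<sigma> \<omega>) \<omega>"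
      using state_at_entry_1[OF \<omega>] by (intro discounted_mono) (simp add: D1)
    consider "?\<sigma> \<omega> < \<tau>2 \<omega>" | "\<tau>2 \<omega> < ?\<sigma> \<omega>" | "?\<sigma> \<omega> = \<tau>2 \<omega>" by (rule linorder_cases)
    then show "stopped_discounted r U X ?\<sigma> (\<tau>2 \<omega>) \<omega> \<le> outcome ?\<sigma> \<tau>2 \<omega>"
    proof cases
      case 1
      with entry show ?thesis by (simp add: stopped_discounted_def)
    next
      case 2
      have "disc U (\<tau>2 \<omega>) \<omega> \<le> disc v (\<tau>2 \<omega>) \<omega>"
        by (rule discounted_mono) (simp add: between[OF in_I])
      with 2 show ?thesis by (auto simp: stopped_discounted_def)
    next
      case 3
      have "disc u (?\<sigma> \<omega>) \<omega> \<le> disc w (?\<sigma> \<omega>) \<omega>"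
        by (rule discounted_mono) (simp add: tie[OF in_I])
      with 3 entry show ?thesis by (simp add: stopped_discounted_def)
    qed
  qed
  finally show ?thesis .
qed

end

end


section \<open>The associated game\<close>

lemma randomisation_devices_independent:
  assumes M: "prob_space M" and dev: "randomisation_devices M F E1 E2"
  shows "E1 \<in> borel_measurable M" "E2 \<in> borel_measurable M"
    and "prob_space.indep_set M (sets (sigma_infinity M F)) (sets (vimage_algebra (space M) E1 borel))"
    and "prob_space.indep_set M (sets (sigma_infinity M F)) (sets (vimage_algebra (space M) E2 borel))"
proof -
  interpret prob_space M by (rule M)
  let ?A = "\<lambda>k::nat. if k = 0 then sets (sigma_infinity M F)
    else if k = 1 then sets (vimage_algebra (space M) E1 borel)
    else sets (vimage_algebra (space M) E2 borel)"
  have dist: "distributed M lborel E1 (exponential_density 1)" "distributed M lborel E2 (exponential_density 1)"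
    and indep: "indep_sets ?A {0, 1, 2}"
    using dev unfolding randomisation_devices_def by blast+
  show "E1 \<in> borel_measurable M" "E2 \<in> borel_measurable M"
    using dist[THEN distributed_measurable] by simp_all
  have "indep_set (?A 0) (?A k)" if k: "k \<in> {1, 2}" for k
  proof (rule indep_setI)
    show "?A 0 \<subseteq> events" "?A k \<subseteq> events"
      using indep k unfolding indep_sets_def by blast+
    fix a b assume "a \<in> ?A 0" "b \<in> ?A k"
    then have "\<forall>j\<in>{0, k}. (if j = 0 then a else b) \<in> ?A j" using k by auto
    then have "prob (\<Inter>j\<in>{0, k}. if j = 0 then a else b) = (\<Prod>j\<in>{0, k}. prob (if j = 0 then a else b))"
      using k by (intro indep_setsD[OF indep]) auto
    then show "prob (a \<inter> b) = prob a * prob b" using k by auto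
  qed
  from this[of 1] this[of 2]
  show "indep_set (sets (sigma_infinity M F)) (sets (vimage_algebra (space M) E1 borel))"
    and "indep_set (sets (sigma_infinity M F)) (sets (vimage_algebra (space M) E2 borel))"
    by simp_all
qed

text \<open>On \<open>g < f\<close> the associated payoffs are the median of \<open>f\<close>, \<open>g\<close>, \<open>h\<close>. Lattice expressions that
  hold on all of \<open>I\<close> make continuity across \<open>f = g\<close> evident.\<close>

lemma associated_payoffs_lattice:
  assumes "associated_payoffs I f g h f' g' h'" and y: "y \<in> I"
  shows "f' y = min (f y) (max (g y) (h y))" "g' y = max (g y) (min (f y) (h y))" "h' y = f' y"
  using assms unfolding associated_payoffs_iff by (auto simp: min_def max_def)

lemma associated_payoffs_continuous:
  assumes payoffs: "associated_payoffs I f g h f' g' h'"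
    and cont: "continuous_on I f" "continuous_on I g" "continuous_on I h"
  shows "continuous_on I f'" "continuous_on I g'" "continuous_on I h'"
proof -
  note lattice = associated_payoffs_lattice[OF payoffs]
  show f': "continuous_on I f'"
    by (rule continuous_on_eq[OF _ lattice(1)[symmetric]]) (intro continuous_intros cont)
  show "continuous_on I g'"
    by (rule continuous_on_eq[OF _ lattice(2)[symmetric]]) (intro continuous_intros cont)
  show "continuous_on I h'"
    by (rule continuous_on_eq[OF f' lattice(3)[symmetric]])
qed

lemma (in stopping_game_setting) associated_game_at:
  assumes payoffs: "associated_payoffs I f g h f' g' h'" and x: "x \<in> I"
  shows "\<exists>H. ordered_stopping_game (M x) (F x) (X x) I x r (\<lambda>y. \<bar>f y\<bar> + \<bar>g y\<bar> + \<bar>h y\<bar>) H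
    f' g' h' (E1 x) (E2 x)"
proof -
  note sol = solution[OF x, unfolded weak_solution_def]
  note lattice = associated_payoffs_lattice[OF payoffs]
  interpret prob_space "M x" using sol by blast
  interpret continuous_adapted_process "M x" "F x" "X x" I x
    by unfold_locales (use sol state_space open_einterval in auto)
  have cont: "continuous_on I f" "continuous_on I g" "continuous_on I h"
    by (auto intro: payoff_continuous)
  obtain H where H: "integrable (M x) H"
    "AE \<omega> in M x. \<forall>t\<ge>0. exp (- r * t) * (\<bar>f (X x t \<omega>)\<bar> + \<bar>g (X x t \<omega>)\<bar> + \<bar>h (X x t \<omega>)\<bar>) \<le> H \<omega>"
    using envelope_exists[OF cont payoff_integrable[OF x]] by blast
  note dev = randomisation_devices_independent[OF prob_space_axioms devices[OF x]]
  note cont' = associated_payoffs_continuous[OF payoffs cont]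
   have "\<bar>f' y\<bar> \<le> \<bar>f y\<bar> + \<bar>g y\<bar> + \<bar>h y\<bar>" "\<bar>g' y\<bar> \<le> \<bar>f y\<bar> + \<bar>g y\<bar> + \<bar>h y\<bar>" "f' y \<le> g' y"
    if "y \<in> I" for y
    using lattice[OF that] by (auto simp: min_def max_def)
  moreover have "0 < E1 x \<omega>" "0 < E2 x \<omega>" if "\<omega> \<in> space (M x)" for \<omega>
    using devices[OF x] that unfolding randomisation_devices_def by blast+
  ultimately have "ordered_stopping_game (M x) (F x) (X x) I x r (\<lambda>y. \<bar>f y\<bar> + \<bar>g y\<bar> + \<bar>h y\<bar>) H
      f' g' h' (E1 x) (E2 x)"
    using H x lattice(3) dev cont' by unfold_locales auto
  then show ?thesis by blast
qed

text \<open>Stopping at once pays the maximiser \<open>f' x\<close> against every \<open>\<tau>2\<close>, and costs the minimiser at most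
  \<open>g' x\<close> against every \<open>\<tau>1\<close>.\<close>

lemma (in stopping_game_setting) associated_value_between:
  assumes payoffs: "associated_payoffs I f g h f' g' h'"
    and val: "is_game_value I r f' g' h' M X E1 E2 V" and x: "x \<in> I"
  shows "f' x \<le> V x" "V x \<le> g' x"
proof -
  obtain H where "ordered_stopping_game (M x) (F x) (X x) I x r (\<lambda>y. \<bar>f y\<bar> + \<bar>g y\<bar> + \<bar>h y\<bar>) H
      f' g' h' (E1 x) (E2 x)"
    using associated_game_at[OF payoffs x] by blast
  then interpret G: ordered_stopping_game "M x" "F x" "X x" I x r "\<lambda>y. \<bar>f y\<bar> + \<bar>g y\<bar> + \<bar>h y\<bar>" H
    f' g' h' "E1 x" "E2 x" .
  have V: "ereal (V x) = (INF \<tau>2\<in>admissible_times (M x) (X x) (E2 x).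
        SUP \<tau>1\<in>admissible_times (M x) (X x) (E1 x). ereal (G.J \<tau>1 \<tau>2))"
      "ereal (V x) = (SUP \<tau>1\<in>admissible_times (M x) (X x) (E1 x).
        INF \<tau>2\<in>admissible_times (M x) (X x) (E2 x). ereal (G.J \<tau>1 \<tau>2))"
    using val x unfolding is_game_value_def by blast+
  have "ereal (f' x) \<le> ereal (V x)"
    unfolding V(2) by (rule SUP_upper2[OF G.zero_admissible], rule INF_greatest) (simp add: G.payoff_stop_at_once_1)
  then show "f' x \<le> V x" by simp
  have "ereal (V x) \<le> ereal (g' x)"
    unfolding V(1) by (rule INF_lower2[OF G.zero_admissible], rule SUP_least) (simp add: G.payoff_stop_at_once_2)
  then show "V x \<le> g' x" by simp
qed

text \<open>Stopping on entry into \<open>D1\<close> secures at least \<open>U x\<close> for the maximiser, and stopping on entry into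
  \<open>D2\<close> secures at most \<open>U x\<close> for the minimiser. The two one-sided guarantees pin down the upper and the
  lower value, and playing the two strategies against each other gives exactly \<open>U x\<close>.\<close>

lemma (in stopping_game_setting) associated_game_verification:
  assumes payoffs: "associated_payoffs I f g h f' g' h'"
    and val: "is_game_value I r f' g' h' M X E1 E2 V"
    and U: "continuous_on I U" and D1: "D1 = {x \<in> I. f' x = U x}" and D2: "D2 = {x \<in> I. g' x = U x}"
    and sub: "\<And>x. x \<in> I \<Longrightarrow> submartingale (M x)
      (extend_filtration (M x) (usual_natural_filtration (M x) (X x)))
      (stopped_discounted r U (X x) (entry_time (X x) D1))"
    and super: "\<And>x. x \<in> I \<Longrightarrow> supermartingale (M x)
      (extend_filtration (M x) (usual_natural_filtration (M x) (X x)))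
      (stopped_discounted r U (X x) (entry_time (X x) D2))"
    and between: "\<And>x. x \<in> I \<Longrightarrow> f' x \<le> U x \<and> U x \<le> g' x"
  shows "\<And>x. x \<in> I \<Longrightarrow> V x = U x"
    and "\<And>x. x \<in> I \<Longrightarrow> game_payoff r f' g' h' (M x) (X x) (entry_time (X x) D1) (entry_time (X x) D2) = U x"
    and "global_markovian_nash I r f' g' h' M X E1 E2 D1 D2"
proof -
  have *: "V x = U x \<and>
      game_payoff r f' g' h' (M x) (X x) (entry_time (X x) D1) (entry_time (X x) D2) = U x \<and>
      entry_time (X x) D1 \<in> admissible_times (M x) (X x) (E1 x) \<and>
      entry_time (X x) D2 \<in> admissible_times (M x) (X x) (E2 x) \<and>
      (\<forall>\<tau>1\<in>admissible_times (M x) (X x) (E1 x).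
         game_payoff r f' g' h' (M x) (X x) \<tau>1 (entry_time (X x) D2) \<le> U x) \<and>
      (\<forall>\<tau>2\<in>admissible_times (M x) (X x) (E2 x).
         U x \<le> game_payoff r f' g' h' (M x) (X x) (entry_time (X x) D1) \<tau>2)" if x: "x \<in> I" for x
  proof -
    obtain H where "ordered_stopping_game (M x) (F x) (X x) I x r (\<lambda>y. \<bar>f y\<bar> + \<bar>g y\<bar> + \<bar>h y\<bar>) H
        f' g' h' (E1 x) (E2 x)"
      using associated_game_at[OF payoffs x] by blast
    then interpret G: ordered_stopping_game "M x" "F x" "X x" I x r "\<lambda>y. \<bar>f y\<bar> + \<bar>g y\<bar> + \<bar>h y\<bar>" H
      f' g' h' "E1 x" "E2 x" .
    let ?T1 = "admissible_times (M x) (X x) (E1 x)" and ?T2 = "admissible_times (M x) (X x) (E2 x)"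
    let ?e1 = "entry_time (X x) D1" and ?e2 = "entry_time (X x) D2"
    have adm: "?e1 \<in> ?T1" "?e2 \<in> ?T2"
      by (rule G.entry_admissible[OF U D1 D2 between]; assumption)+
    have up: "G.J \<tau>1 ?e2 \<le> U x" if "\<tau>1 \<in> ?T1" for \<tau>1
      by (rule G.entry_D2_guarantees_minimiser[OF U D1 D2 between super[OF x] that])
    have low: "U x \<le> G.J ?e1 \<tau>2" if "\<tau>2 \<in> ?T2" for \<tau>2
      by (rule G.entry_D1_guarantees_maximiser[OF U D1 D2 between sub[OF x] that])
    have V: "ereal (V x) = (INF \<tau>2\<in>?T2. SUP \<tau>1\<in>?T1. ereal (G.J \<tau>1 \<tau>2))"
        "ereal (V x) = (SUP \<tau>1\<in>?T1. INF \<tau>2\<in>?T2. ereal (G.J \<tau>1 \<tau>2))"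
      using val x unfolding is_game_value_def by blast+
    have "ereal (V x) \<le> ereal (U x)"
      unfolding V(1) by (rule INF_lower2[OF adm(2)], rule SUP_least) (simp add: up)
    moreover have "ereal (U x) \<le> ereal (V x)"
      unfolding V(2) by (rule SUP_upper2[OF adm(1)], rule INF_greatest) (simp add: low)
    ultimately show ?thesis
      using adm up low by (auto intro: antisym)
  qed
  then show "\<And>x. x \<in> I \<Longrightarrow> V x = U x"
    and "\<And>x. x \<in> I \<Longrightarrow> game_payoff r f' g' h' (M x) (X x) (entry_time (X x) D1) (entry_time (X x) D2) = U x"
    by blast+
  have cont': "continuous_on I f'" "continuous_on I g'"
    by (rule associated_payoffs_continuous[OF payoffs]; simp add: payoff_continuous)+
  have I: "I \<in> sets borel" using state_space open_einterval by simp
  have zero_borel: "{x \<in> I. w x = U x} \<in> sets borel" if w: "continuous_on I w" for w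
  proof -
    have "(\<lambda>x. w x - U x) \<in> borel_measurable (restrict_space borel I)"
      by (rule borel_measurable_continuous_on_restrict) (intro continuous_intros w U)
    then have "(\<lambda>x. w x - U x) -` {0} \<inter> space (restrict_space borel I) \<in> sets (restrict_space borel I)"
      by (rule measurable_sets) simp
    also have "(\<lambda>x. w x - U x) -` {0} \<inter> space (restrict_space borel I) = {x \<in> I. w x = U x}"
      by (auto simp: space_restrict_space)
    finally show ?thesis using I by (simp add: sets_restrict_space_iff)
  qed
  have "D1 \<in> sets borel" "D2 \<in> sets borel"
    unfolding D1 D2 by (intro zero_borel cont')+
  with * show "global_markovian_nash I r f' g' h' M X E1 E2 D1 D2"
    unfolding global_markovian_nash_def by (auto simp: D1 D2)
qed

theorem proposition7:
  fixes \<alpha> \<beta> :: ereal and I :: "real set" and \<mu> \<sigma> :: "real \<Rightarrow> real"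
    and M :: "real \<Rightarrow> 'w measure" and F :: "real \<Rightarrow> real \<Rightarrow> 'w measure"
    and W X :: "real \<Rightarrow> real \<Rightarrow> 'w \<Rightarrow> real" and E1 E2 :: "real \<Rightarrow> 'w \<Rightarrow> real"
    and r :: real and f g h f' g' h' V :: "real \<Rightarrow> real" and D1s D2s :: "real set"
  assumes setting: "stopping_game_setting \<alpha> \<beta> I \<mu> \<sigma> M F W X E1 E2 r f g h"
    and payoffs: "associated_payoffs I f g h f' g' h'"
    and game_value: "is_game_value I r f' g' h' M X E1 E2 V"
    and D1s: "D1s = {x \<in> I. f' x = V x}"
    and D2s: "D2s = {x \<in> I. g' x = V x}"
  shows
    "(\<forall>U D1 D2.
        continuous_on I U \<longrightarrow>
        D1 = {x \<in> I. f' x = U x} \<longrightarrow>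
        D2 = {x \<in> I. g' x = U x} \<longrightarrow>
        (\<forall>x\<in>I. submartingale (M x)
                  (extend_filtration (M x) (usual_natural_filtration (M x) (X x)))
                  (stopped_discounted r U (X x) (entry_time (X x) D1))) \<longrightarrow>
        (\<forall>x\<in>I. supermartingale (M x)
                  (extend_filtration (M x) (usual_natural_filtration (M x) (X x)))
                  (stopped_discounted r U (X x) (entry_time (X x) D2))) \<longrightarrow>
        (\<forall>x\<in>I. f' x \<le> U x \<and> U x \<le> g' x) \<longrightarrow>
        (\<forall>x\<in>I. V x = U x) \<and> D1s = D1 \<and> D2s = D2 \<and>
        global_markovian_nash I r f' g' h' M X E1 E2 D1 D2 \<and>
        (\<forall>x\<in>I. game_payoff r f' g' h' (M x) (X x)
                  (entry_time (X x) D1) (entry_time (X x) D2) = U x))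
     \<and>
     (D1s \<inter> D2s = set_le I g f \<and>
      (\<forall>x\<in>D1s. V x = f' x) \<and>
      (\<forall>x\<in>D2s. V x = g' x) \<and>
      (\<forall>x\<in>D1s \<inter> D2s. V x = f' x \<and> f' x = g' x) \<and>
      B1 I f g h \<subseteq> D1s \<inter> D2s \<and> (\<forall>x\<in>B1 I f g h. V x = h x) \<and>
      B3 I f g h \<subseteq> D1s \<inter> D2s \<and> (\<forall>x\<in>B3 I f g h. V x = g x) \<and>
      B4 I f g h \<subseteq> D1s \<inter> D2s \<and> (\<forall>x\<in>B4 I f g h. V x = f x) \<and>
      D1s \<inter> D2s \<inter> set_le I f g = set_eq I f g \<and>
      (\<forall>x\<in>D1s \<inter> set_le I f g. V x = f x) \<and>
      (\<forall>x\<in>D2s \<inter> set_le I f g. V x = g x) \<and>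
      (\<forall>x\<in>D1s \<inter> D2s \<inter> set_le I f g. V x = f x \<and> f x = g x) \<and>
      (\<forall>x\<in>I. (f x \<le> V x \<and> V x \<le> g x) \<or> (g x \<le> V x \<and> V x \<le> f x)))"
proof (intro conjI)
  interpret stopping_game_setting \<alpha> \<beta> I \<mu> \<sigma> M F W X E1 E2 r f g h by (rule setting)
  note lattice = associated_payoffs_lattice[OF payoffs]
  note between = associated_value_between[OF payoffs game_value]
  have V: "f' x \<le> V x" "V x \<le> g' x" "f' x = min (f x) (max (g x) (h x))"
      "g' x = max (g x) (min (f x) (h x))" if "x \<in> I" for x
    using that between lattice by blast+
  have pointwise:
      "g x \<le> h x \<Longrightarrow> h x \<le> f x \<Longrightarrow> V x = h x" "h x < g x \<Longrightarrow> g x < f x \<Longrightarrow> V x = g x"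
      "g x < f x \<Longrightarrow> f x < h x \<Longrightarrow> V x = f x" "f x \<le> g x \<Longrightarrow> f' x = f x \<and> g' x = g x"
      "(f x \<le> V x \<and> V x \<le> g x) \<or> (g x \<le> V x \<and> V x \<le> f x)" if "x \<in> I" for x
    using V[OF that] by (auto simp: min_def max_def split: if_splits)
  show "\<forall>U D1 D2. continuous_on I U \<longrightarrow> D1 = {x \<in> I. f' x = U x} \<longrightarrow> D2 = {x \<in> I. g' x = U x} \<longrightarrow>
        (\<forall>x\<in>I. submartingale (M x)
                  (extend_filtration (M x) (usual_natural_filtration (M x) (X x)))
                  (stopped_discounted r U (X x) (entry_time (X x) D1))) \<longrightarrow>
        (\<forall>x\<in>I. supermartingale (M x)
                  (extend_filtration (M x) (usual_natural_filtration (M x) (X x)))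
                  (stopped_discounted r U (X x) (entry_time (X x) D2))) \<longrightarrow>
        (\<forall>x\<in>I. f' x \<le> U x \<and> U x \<le> g' x) \<longrightarrow>
        (\<forall>x\<in>I. V x = U x) \<and> D1s = D1 \<and> D2s = D2 \<and>
        global_markovian_nash I r f' g' h' M X E1 E2 D1 D2 \<and>
        (\<forall>x\<in>I. game_payoff r f' g' h' (M x) (X x)
                  (entry_time (X x) D1) (entry_time (X x) D2) = U x)"
  proof (intro allI impI)
    fix U D1 D2
    assume "continuous_on I U" "D1 = {x \<in> I. f' x = U x}" "D2 = {x \<in> I. g' x = U x}"
      "\<forall>x\<in>I. submartingale (M x) (extend_filtration (M x) (usual_natural_filtration (M x) (X x)))
         (stopped_discounted r U (X x) (entry_time (X x) D1))"
      "\<forall>x\<in>I. supermartingale (M x) (extend_filtration (M x) (usual_natural_filtration (M x) (X x)))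
         (stopped_discounted r U (X x) (entry_time (X x) D2))"
      "\<forall>x\<in>I. f' x \<le> U x \<and> U x \<le> g' x"
    note ver = associated_game_verification[OF payoffs game_value this(1-3) bspec[OF this(4)]
        bspec[OF this(5)] bspec[OF this(6)]]
    have "D1s = D1" "D2s = D2"
      using ver(1) \<open>D1 = _\<close> \<open>D2 = _\<close> unfolding D1s D2s by auto
    with ver show "(\<forall>x\<in>I. V x = U x) \<and> D1s = D1 \<and> D2s = D2 \<and>
        global_markovian_nash I r f' g' h' M X E1 E2 D1 D2 \<and>
        (\<forall>x\<in>I. game_payoff r f' g' h' (M x) (X x)
                  (entry_time (X x) D1) (entry_time (X x) D2) = U x)"
      by blast
  qed
  \<comment> \<open>If \<open>f x < g x\<close>, then \<open>f' x < g' x\<close>, and \<open>V x\<close> cannot equal both; if \<open>g x \<le> f x\<close>, then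
     \<open>f' x = g' x\<close> leaves \<open>V x\<close> no room.\<close>
  have meet: "x \<in> D1s \<inter> D2s \<longleftrightarrow> x \<in> I \<and> g x \<le> f x" for x
  proof (cases "x \<in> I")
    case True
    show ?thesis using V[OF True] unfolding D1s D2s by (auto simp: min_def max_def split: if_splits)
  qed (simp add: D1s)
  then show "D1s \<inter> D2s = set_le I g f" by (auto simp: set_le_def)
  from meet have meet_eq: "D1s \<inter> D2s = {x \<in> I. g x \<le> f x}" by blast
  show "B1 I f g h \<subseteq> D1s \<inter> D2s" "B3 I f g h \<subseteq> D1s \<inter> D2s" "B4 I f g h \<subseteq> D1s \<inter> D2s"
    unfolding meet_eq by (auto simp: B1_def B3_def B4_def)
  show "D1s \<inter> D2s \<inter> set_le I f g = set_eq I f g"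
    unfolding meet_eq by (auto simp: set_le_def set_eq_def)
  show "\<forall>x\<in>D1s. V x = f' x" "\<forall>x\<in>D2s. V x = g' x" "\<forall>x\<in>D1s \<inter> D2s. V x = f' x \<and> f' x = g' x"
    by (auto simp: D1s D2s)
  show "\<forall>x\<in>B1 I f g h. V x = h x" "\<forall>x\<in>B3 I f g h. V x = g x" "\<forall>x\<in>B4 I f g h. V x = f x"
    using pointwise(1-3) by (auto simp: B1_def B3_def B4_def)
  show "\<forall>x\<in>D1s \<inter> set_le I f g. V x = f x" "\<forall>x\<in>D2s \<inter> set_le I f g. V x = g x"
      "\<forall>x\<in>D1s \<inter> D2s \<inter> set_le I f g. V x = f x \<and> f x = g x"
    using pointwise(4) unfolding D1s D2s set_le_def by auto
  show "\<forall>x\<in>I. (f x \<le> V x \<and> V x \<le> g x) \<or> (g x \<le> V x \<and> V x \<le> f x)"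
    using pointwise(5) by blast
qed

end
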